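(* The elements $U_{ij},V_{ij}$, $i,j\in\mathbb{Z}$, belong to $\mathbb{Z}\mathbb{T}_\infty$ and satisfy, for all $i,j\in\mathbb{Z}$: $$U_{i+1,j}A_jV_{j+1,i}=B_i^{-1}+U_{i+1,j+1}\overline A_jV_{ji},\qquad V_{i+1,j}B_jU_{j+1,i}=A_i^{-1}+V_{i+1,j+1}\overline B_jU_{ji},$$ $$U_{ij}A_jV_{j+1,i}=U_{i,j+1}\overline A_jV_{ji},\qquad V_{ij}B_jU_{j+1,i}=V_{i,j+1}\overline B_jU_{ji}.$$ Furthermore, the elements $H_{ij}^\pm\in Frac(\mathbb{Z}\mathbb{T}_\infty)$, $i,j\in\mathbb{Z}$, given by $$H_{ij}^+:=U_{ji}^{-1}(U_{j,i-1}A_{i-1}+U_{j,i+1}\overline A_i),\qquad H_{ij}^-:=V_{ji}^{-1}(V_{j,i-1}B_{i-1}+V_{j,i+1}\overline B_i),$$ do not depend on $j$ and belong to $\mathbb{Z}\mathbb{T}_\infty$.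
   Context: Let $I=\{i_-:i\in\mathbb{Z}\}\sqcup\{i_+:i\in\mathbb{Z}\}$ be marked points on the two boundary lines of an infinite strip $\Sigma_\infty$ (the points $i_-$ on one line, $i_+$ on the other, both ordered in the same direction along the strip). Order $I$ by: $i_-<j_-$ iff $i<j$; $i_-<j_+$ for all $i,j$; $i_+<j_+$ iff $i>j$. A sequence of distinct elements of $I$ is cyclic if some cyclic rotation of it is strictly increasing (so a cyclic quadruple lists the vertices of a convex quadrilateral in order). ${\mathcal A}_{\Sigma_\infty}$ is the $\mathbb{Q}$-algebra generated by $x_{ab}^{\pm1}$, $a,b\in I$, $a\neq b$, subject to: $x_{ab}x_{cb}^{-1}x_{ca}=x_{ac}x_{bc}^{-1}x_{ba}$ for all distinct $a,b,c\in I$; $x_{bd}=x_{bc}x_{ac}^{-1}x_{ad}+x_{ba}x_{ca}^{-1}x_{cd}$ for all cyclic $(a,b,c,d)$ in $I$ (equivalently it is the direct limit of the noncommutative polygon algebras of finite convex sub-polygons). The triangulation $\Delta_\infty$ of $\Sigma_\infty$ consists of the pairs $(i_\pm,(i+1)_\pm)$, $((i+1)_\pm,i_\pm)$, $(i_-,i_+)$, $(i_+,i_-)$, $(i_-,(i+1)_+)$, $((i+1)_+,i_-)$, $i\in\mathbb{Z}$. $\mathbb{T}_\infty$ is the group generated by $t_{ab}$, $(a,b)\in\Delta_\infty$, subject to $t_{ab}t_{cb}^{-1}t_{ca}=t_{ac}t_{bc}^{-1}t_{ba}$ for all distinct $a,b,c$ with all of $(a,b),(b,c),(c,a)$ in $\Delta_\infty$.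 The assignments $t_{ab}\mapsto x_{ab}$ define an injective homomorphism $\mathbb{Z}\mathbb{T}_\infty\to{\mathcal A}_{\Sigma_\infty}$, by which $\mathbb{Z}\mathbb{T}_\infty$ is regarded as a subring of ${\mathcal A}_{\Sigma_\infty}$. $Frac(\mathbb{Z}\mathbb{T}_\infty)$ is the universal skew field of fractions of this group ring ($\mathbb{T}_\infty$ is a free group). Put $U_{ij}:=x_{i_-,j_+}$, $V_{ij}:=x_{i_+,j_-}$, $A_j:=x_{(j+1)_+,j_+}^{-1}$, $\overline A_j:=x_{j_+,(j+1)_+}^{-1}$, $B_j:=x_{(j+1)_-,j_-}^{-1}$, $\overline B_j:=x_{j_-,(j+1)_-}^{-1}$. *)

theory Defs
  imports
    "HOL-Library.Poly_Mapping"
    "HOL-Algebra.Subrings"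
    "HOL-Algebra.Algebraic_Closure_Type"
begin

text \<open>
  A word over generators of type \<open>'g\<close> is a list of letters \<open>(g, True)\<close>, standing for \<open>g\<close>,
  and \<open>(g, False)\<close>, standing for the inverse of \<open>g\<close>.
  \<open>pres_eq R\<close> is equality in the group presented by the relations \<open>u = v\<close>, \<open>(u, v) \<in> R\<close>.
\<close>

type_synonym 'g word = "('g \<times> bool) list"

inductive pres_eq :: "('g word \<times> 'g word) set \<Rightarrow> 'g word \<Rightarrow> 'g word \<Rightarrow> bool"
  for R where
  pres_refl: "pres_eq R u u"
| pres_sym: "pres_eq R u v \<Longrightarrow> pres_eq R v u"
| pres_trans: "pres_eq R u v \<Longrightarrow> pres_eq R v w \<Longrightarrow> pres_eq R u w"
| pres_cancel: "pres_eq R (u @ [(g, s), (g, \<not> s)] @ v) (u @ v)"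
| pres_rel: "(r, r') \<in> R \<Longrightarrow> pres_eq R (u @ r @ v) (u @ r' @ v)"

lemma equivp_pres_eq: "equivp (pres_eq R)"
  by (intro equivpI reflpI sympI transpI) (blast intro: pres_eq.intros)+

lemma pres_eq_context: "pres_eq R u v \<Longrightarrow> pres_eq R (p @ u @ q) (p @ v @ q)"
proof (induction rule: pres_eq.induct)
  case (pres_cancel u g s v)
  show ?case using pres_eq.pres_cancel[of R "p @ u" g s "v @ q"] by simp
next
  case (pres_rel r r' u v)
  then show ?case using pres_eq.pres_rel[of r r' R "p @ u" "v @ q"] by simp
qed (blast intro: pres_eq.intros)+

lemma pres_eq_append:
  assumes "pres_eq R u u'" "pres_eq R v v'"
  shows "pres_eq R (u @ v) (u' @ v')"
  using pres_eq_context[OF assms(1), of "[]" v] pres_eq_context[OF assms(2), of u' "[]"]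
  by (auto intro: pres_trans)

definition word_inv :: "'g word \<Rightarrow> 'g word" where
  "word_inv w = rev (map (\<lambda>(g, s). (g, \<not> s)) w)"

lemma word_inv_append: "word_inv (u @ v) = word_inv v @ word_inv u"
  by (simp add: word_inv_def)

lemma word_inv_inv: "word_inv (word_inv w) = w"
  by (induction w) (auto simp: word_inv_def)

lemma word_inv_right: "pres_eq R (w @ word_inv w) []"
proof (induction w rule: rev_induct)
  case Nil
  then show ?case by (simp add: word_inv_def pres_refl)
next
  case (snoc l w)
  obtain g s where l: "l = (g, s)" by fastforce
  have "pres_eq R (w @ [(g, s), (g, \<not> s)] @ word_inv w) (w @ word_inv w)"
    by (rule pres_cancel)
  with snoc show ?case
    by (auto simp: l word_inv_def intro: pres_trans)
qed

lemma word_inv_left: "pres_eq R (word_inv w @ w) []"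
  using word_inv_right[of R "word_inv w"] by (simp add: word_inv_inv)

lemma pres_eq_word_inv:
  assumes "pres_eq R u v"
  shows "pres_eq R (word_inv u) (word_inv v)"
proof -
  have "pres_eq R (word_inv u @ (v @ word_inv v)) (word_inv u @ [])"
    by (intro pres_eq_append pres_refl word_inv_right)
  moreover have "pres_eq R ((word_inv u @ v) @ word_inv v) ((word_inv u @ u) @ word_inv v)"
    by (intro pres_eq_append pres_refl pres_sym[OF assms])
  moreover have "pres_eq R ((word_inv u @ u) @ word_inv v) ([] @ word_inv v)"
    by (intro pres_eq_append pres_refl word_inv_left)
  ultimately show ?thesis
    by (simp) (meson pres_sym pres_trans)
qed

lemma prod_list_pres_eq:
  fixes ev :: "'g \<times> bool \<Rightarrow> 'r::monoid_mult"
  assumes "pres_eq R u v"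
    and "\<And>g s. ev (g, s) * ev (g, \<not> s) = 1"
    and "\<And>r r'. (r, r') \<in> R \<Longrightarrow> prod_list (map ev r) = prod_list (map ev r')"
  shows "prod_list (map ev u) = prod_list (map ev v)"
  using assms(1)
proof (induction rule: pres_eq.induct)
  case (pres_cancel u g s v)
  have "ev (g, s) * (ev (g, \<not> s) * y) = y" for y
    by (metis assms(2) mult.assoc mult_1)
  then show ?case by simp
qed (auto simp: assms(3))

text \<open>
  The free group on \<open>'g\<close>, written additively so that \<open>'g free_group \<Rightarrow>\<^sub>0 'r\<close> with the convolution
  product of \<^theory>\<open>HOL-Library.Poly_Mapping\<close> is its group ring over \<open>'r\<close>.
\<close>

quotient_type 'g free_group = "'g word" / "pres_eq {}"
  by (rule equivp_pres_eq)

instantiation free_group :: (type) group_add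
begin

lift_definition zero_free_group :: "'a free_group" is "[]" .

lift_definition plus_free_group :: "'a free_group \<Rightarrow> 'a free_group \<Rightarrow> 'a free_group" is "(@)"
  by (rule pres_eq_append)

lift_definition uminus_free_group :: "'a free_group \<Rightarrow> 'a free_group" is word_inv
  by (rule pres_eq_word_inv)

definition minus_free_group :: "'a free_group \<Rightarrow> 'a free_group \<Rightarrow> 'a free_group" where
  "minus_free_group a b = a + - b"

instance
  by intro_classes
    (simp add: minus_free_group_def | transfer, simp add: pres_refl word_inv_left)+

end

lift_definition free_gen :: "'g \<Rightarrow> 'g free_group" is "\<lambda>g. [(g, True)]" .

text \<open>
  The linear extension to a group (or monoid) ring of a map \<open>m\<close> on the group,
  \<open>c\<close> being the structure map on coefficients.
\<close>

definition lin_ext :: "('c \<Rightarrow> 'r) \<Rightarrow> ('g \<Rightarrow> 'r) \<Rightarrow> ('g \<Rightarrow>\<^sub>0 'c::zero) \<Rightarrow> 'r::semiring_1" where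
  "lin_ext c m f = (\<Sum>g\<in>Poly_Mapping.keys f. c (Poly_Mapping.lookup f g) * m g)"

lemma poly_mapping_single_induct [case_names zero single_plus]:
  assumes "P 0"
    and "\<And>g a f. P f \<Longrightarrow> P (Poly_Mapping.single g a + f)"
  shows "P f"
proof (induction f rule: update_induct)
  case const
  show ?case by (rule assms(1))
next
  case (update f g a)
  have "Poly_Mapping.update g a f = Poly_Mapping.single g a + f"
    by (rule poly_mapping_eqI)
      (use update(1) in \<open>auto simp: lookup_add lookup_single lookup_update in_keys_iff when_def\<close>)
  with update(3) assms(2) show ?case by simp
qed

locale lin_ext_hom =
  fixes c :: "'c::ring_1 \<Rightarrow> 'r::ring_1" and m :: "'g::monoid_add \<Rightarrow> 'r"
  assumes c_add: "c (a + b) = c a + c b"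
    and c_mult: "c (a * b) = c a * c b"
    and c_one: "c 1 = 1"
    and c_central: "c a * y = y * c a"
    and m_zero: "m 0 = 1"
    and m_add: "m (g + h) = m g * m h"
begin

lemma c_zero: "c 0 = 0"
  using c_add[of 0 0] by simp

lemma lin_ext_superset:
  assumes "finite S" "Poly_Mapping.keys f \<subseteq> S"
  shows "lin_ext c m f = (\<Sum>g\<in>S. c (Poly_Mapping.lookup f g) * m g)"
  unfolding lin_ext_def
  by (rule sum.mono_neutral_left) (use assms in \<open>auto simp: c_zero in_keys_iff\<close>)

lemma lin_ext_add: "lin_ext c m (f + f') = lin_ext c m f + lin_ext c m f'"
proof -
  let ?S = "Poly_Mapping.keys f \<union> Poly_Mapping.keys f'"
  have "lin_ext c m h = (\<Sum>g\<in>?S. c (Poly_Mapping.lookup h g) * m g)" if "Poly_Mapping.keys h \<subseteq> ?S" for h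
    using that by (intro lin_ext_superset) auto
  then show ?thesis
    by (simp add: Poly_Mapping.keys_add lookup_add c_add algebra_simps sum.distrib)
qed

lemma lin_ext_single: "lin_ext c m (Poly_Mapping.single g a) = c a * m g"
  by (simp add: lin_ext_def c_zero)

lemma lin_ext_zero: "lin_ext c m 0 = 0"
  by (simp add: lin_ext_def)

lemma lin_ext_one: "lin_ext c m 1 = 1"
  using lin_ext_single[of 0 1] by (simp add: c_one m_zero)

lemma lin_ext_uminus: "lin_ext c m (- f) = - lin_ext c m f"
  using lin_ext_add[of f "- f"] by (simp add: lin_ext_zero eq_neg_iff_add_eq_0 add.commute)

lemma lin_ext_minus: "lin_ext c m (f - f') = lin_ext c m f - lin_ext c m f'"
  using lin_ext_add[of f "- f'"] by (simp add: lin_ext_uminus)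

lemma lin_ext_mult: "lin_ext c m (f * f') = lin_ext c m f * lin_ext c m f'"
proof -
  have single: "lin_ext c m (Poly_Mapping.single g a * f') = c a * m g * lin_ext c m f'" for g a
  proof (induction f' rule: poly_mapping_single_induct)
    case zero
    then show ?case by (simp add: lin_ext_zero)
  next
    case (single_plus k v h)
    have "m g * (c v * m k) = c v * (m g * m k)"
      by (metis c_central mult.assoc)
    with single_plus show ?case
      by (simp add: distrib_left lin_ext_add mult_single lin_ext_single c_mult m_add mult.assoc)
  qed
  show ?thesis
  proof (induction f rule: poly_mapping_single_induct)
    case zero
    then show ?case by (simp add: lin_ext_zero)
  next
    case (single_plus k v h)
    then show ?case by (simp add: distrib_right lin_ext_add single lin_ext_single)
  qed
qed

end

lemma ring_ring_of_type_algebra: "ring (ring_of_type_algebra :: 'a::ring_1 ring)"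
proof -
  have "\<exists>y. x + y = 0" for x :: 'a
    using add.right_inverse by blast
  then show ?thesis
    unfolding ring_of_type_algebra_def using add.right_inverse
    by unfold_locales (auto simp: algebra_simps Units_def)
qed

definition skew_field :: "('k, 'n) ring_scheme \<Rightarrow> bool" where
  "skew_field K \<longleftrightarrow> ring K \<and> Units K = carrier K - {\<zero>\<^bsub>K\<^esub>}"

text \<open>
  An epic \<open>R\<close>-field in the sense of P. M. Cohn: a skew field with a homomorphism from \<open>R\<close>
  whose image generates it as a skew field.
\<close>

definition epic_field ::
  "('r, 'm) ring_scheme \<Rightarrow> ('k, 'n) ring_scheme \<Rightarrow> ('r \<Rightarrow> 'k) \<Rightarrow> bool" where
  "epic_field R K f \<longleftrightarrow>
     skew_field K \<and> f \<in> ring_hom R K \<and>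
     (\<forall>S. subring S K \<and> f ` carrier R \<subseteq> S \<and> (\<forall>x\<in>S - {\<zero>\<^bsub>K\<^esub>}. inv\<^bsub>K\<^esub> x \<in> S) \<longrightarrow> S = carrier K)"

text \<open>
  A specialization from \<open>(K, f)\<close> to \<open>(L, g)\<close> is represented by a local homomorphism \<open>h\<close> over \<open>R\<close>
  from a subring \<open>S\<close> of \<open>K\<close> containing the image of \<open>R\<close> to \<open>L\<close>: the elements of \<open>S\<close> outside the
  kernel of \<open>h\<close> are invertible in \<open>S\<close>.  Two such maps agree on a subring on which they again
  restrict to a local homomorphism, hence represent the same specialization; so uniqueness of the
  specialization in the universal property is automatic and not stated.
\<close>

definition local_hom ::
  "('r, 'm) ring_scheme \<Rightarrow> ('k, 'n) ring_scheme \<Rightarrow> ('r \<Rightarrow> 'k) \<Rightarrow> ('l, 'o) ring_scheme \<Rightarrow> ('r \<Rightarrow> 'l)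
     \<Rightarrow> 'k set \<Rightarrow> ('k \<Rightarrow> 'l) \<Rightarrow> bool" where
  "local_hom R K f L g S h \<longleftrightarrow>
     subring S K \<and> f ` carrier R \<subseteq> S \<and>
     h \<in> ring_hom (K\<lparr>carrier := S\<rparr>) L \<and>
     (\<forall>r\<in>carrier R. h (f r) = g r) \<and>
     (\<forall>x\<in>S. h x \<noteq> \<zero>\<^bsub>L\<^esub> \<longrightarrow> x \<in> Units (K\<lparr>carrier := S\<rparr>))"

text \<open>
  The universal \<open>R\<close>-field, with \<open>R\<close> embedded.  An epic \<open>R\<close>-field has at most as many elements as
  \<open>R\<close> and the natural numbers together, so every one of them has an isomorphic copy with carrier
  in the type \<open>'r + nat\<close>.
\<close>

definition universal_field_of_fractions ::
  "('r, 'm) ring_scheme \<Rightarrow> ('k, 'n) ring_scheme \<Rightarrow> ('r \<Rightarrow> 'k) \<Rightarrow> bool" where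
  "universal_field_of_fractions R K f \<longleftrightarrow>
     epic_field R K f \<and> inj_on f (carrier R) \<and>
     (\<forall>(L :: ('r + nat) ring) g. epic_field R L g \<longrightarrow> (\<exists>S h. local_hom R K f L g S h))"

datatype mark = Minus int | Plus int

instantiation mark :: linorder
begin

fun less_mark :: "mark \<Rightarrow> mark \<Rightarrow> bool" where
  "less_mark (Minus i) (Minus j) \<longleftrightarrow> i < j"
| "less_mark (Minus i) (Plus j) \<longleftrightarrow> True"
| "less_mark (Plus i) (Minus j) \<longleftrightarrow> False"
| "less_mark (Plus i) (Plus j) \<longleftrightarrow> i > j"

definition less_eq_mark :: "mark \<Rightarrow> mark \<Rightarrow> bool" where
  "less_eq_mark a b \<longleftrightarrow> a < b \<or> a = b"

instance
proof
  fix a b c :: mark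
  show "(a < b) = (a \<le> b \<and> \<not> b \<le> a)"
    by (cases a; cases b) (auto simp: less_eq_mark_def)
  show "a \<le> a" by (simp add: less_eq_mark_def)
  show "a \<le> b \<Longrightarrow> b \<le> c \<Longrightarrow> a \<le> c"
    by (cases a; cases b; cases c) (auto simp: less_eq_mark_def)
  show "a \<le> b \<Longrightarrow> b \<le> a \<Longrightarrow> a = b"
    by (cases a; cases b) (auto simp: less_eq_mark_def)
  show "a \<le> b \<or> b \<le> a"
    by (cases a; cases b) (auto simp: less_eq_mark_def)
qed

end

definition cyclic_seq :: "mark list \<Rightarrow> bool" where
  "cyclic_seq as \<longleftrightarrow> distinct as \<and> (\<exists>n. sorted_wrt (<) (rotate n as))"

typedef arrow = "{(a, b). a \<noteq> b} :: (mark \<times> mark) set"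
  by (rule exI[of _ "(Minus 0, Plus 0)"]) simp

type_synonym free_alg = "arrow free_group \<Rightarrow>\<^sub>0 rat"

definition fx :: "mark \<Rightarrow> mark \<Rightarrow> free_alg" where
  "fx a b = Poly_Mapping.single (free_gen (Abs_arrow (a, b))) 1"

definition fx_inv :: "mark \<Rightarrow> mark \<Rightarrow> free_alg" where
  "fx_inv a b = Poly_Mapping.single (- free_gen (Abs_arrow (a, b))) 1"

definition strip_rels :: "free_alg set" where
  "strip_rels =
     {fx a b * fx_inv c b * fx c a - fx a c * fx_inv b c * fx b a | a b c. distinct [a, b, c]} \<union>
     {fx b d - (fx b c * fx_inv a c * fx a d + fx b a * fx_inv c a * fx c d) | a b c d.
        cyclic_seq [a, b, c, d]}"

definition strip_ideal :: "free_alg set" where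
  "strip_ideal = Idl\<^bsub>ring_of_type_algebra\<^esub> strip_rels"

lemma ideal_strip_ideal: "ideal strip_ideal (ring_of_type_algebra :: free_alg ring)"
  unfolding strip_ideal_def
  by (rule ring.genideal_ideal[OF ring_ring_of_type_algebra])
    (simp add: ring_of_type_algebra_def)

lemma strip_rels_ideal: "strip_rels \<subseteq> strip_ideal"
  unfolding strip_ideal_def
  by (rule ring.genideal_self[OF ring_ring_of_type_algebra])
    (simp add: ring_of_type_algebra_def)

lemma
  shows strip_ideal_zero: "0 \<in> strip_ideal"
    and strip_ideal_add: "p \<in> strip_ideal \<Longrightarrow> q \<in> strip_ideal \<Longrightarrow> p + q \<in> strip_ideal"
    and strip_ideal_mult_left: "p \<in> strip_ideal \<Longrightarrow> r * p \<in> strip_ideal"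
    and strip_ideal_mult_right: "p \<in> strip_ideal \<Longrightarrow> p * r \<in> strip_ideal"
proof -
  interpret ideal strip_ideal "ring_of_type_algebra :: free_alg ring"
    by (rule ideal_strip_ideal)
  show "0 \<in> strip_ideal"
    using additive_subgroup.zero_closed[OF is_additive_subgroup] by (simp add: ring_of_type_algebra_def)
  show "p \<in> strip_ideal \<Longrightarrow> q \<in> strip_ideal \<Longrightarrow> p + q \<in> strip_ideal"
    using additive_subgroup.a_closed[OF is_additive_subgroup, of p q] by (simp add: ring_of_type_algebra_def)
  show "p \<in> strip_ideal \<Longrightarrow> r * p \<in> strip_ideal"
    using I_l_closed[of p r] by (simp add: ring_of_type_algebra_def)
  show "p \<in> strip_ideal \<Longrightarrow> p * r \<in> strip_ideal"
    using I_r_closed[of p r] by (simp add: ring_of_type_algebra_def)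
qed

lemma strip_ideal_uminus: "p \<in> strip_ideal \<Longrightarrow> - p \<in> strip_ideal"
  using strip_ideal_mult_left[of p "- 1"] by simp

lemma strip_ideal_minus: "p \<in> strip_ideal \<Longrightarrow> q \<in> strip_ideal \<Longrightarrow> p - q \<in> strip_ideal"
  using strip_ideal_add[of p "- q"] strip_ideal_uminus[of q] by simp

lemma cyclic_seq4_cases:
  assumes "cyclic_seq [a, b, c, d]"
  obtains "a < b" "b < c" "c < d" | "b < c" "c < d" "d < a"
    | "c < d" "d < a" "a < b" | "d < a" "a < b" "b < c"
proof -
  obtain n where n: "sorted_wrt (<) (rotate n [a, b, c, d])"
    using assms by (auto simp: cyclic_seq_def)
  define k where "k = n mod 4"
  have "rotate n [a, b, c, d] = rotate k [a, b, c, d]"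
    by (simp add: k_def rotate_conv_mod[of n])
  moreover have "k = 0 \<or> k = 1 \<or> k = 2 \<or> k = 3"
    by (auto simp: k_def)
  moreover have "rotate 0 [a, b, c, d] = [a, b, c, d]" "rotate 1 [a, b, c, d] = [b, c, d, a]"
    "rotate 2 [a, b, c, d] = [c, d, a, b]" "rotate 3 [a, b, c, d] = [d, a, b, c]"
    by (simp_all add: rotate_def numeral_2_eq_2 numeral_3_eq_3)
  ultimately have "sorted_wrt (<) [a, b, c, d] \<or> sorted_wrt (<) [b, c, d, a] \<or>
      sorted_wrt (<) [c, d, a, b] \<or> sorted_wrt (<) [d, a, b, c]"
    using n by metis
  then show thesis
    using that by auto
qed

text \<open>
  The quotient is not the zero ring: order-preserving positions \<open>p\<close> of the marked points on the
  rational line give the commutative solution \<open>x\<^bsub>ab\<^esub> = \<bar>p a - p b\<bar>\<close> of the relations.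
\<close>

fun mark_pos :: "mark \<Rightarrow> rat" where
  "mark_pos (Minus i) = of_int i / (1 + of_int \<bar>i\<bar>)"
| "mark_pos (Plus i) = 3 - of_int i / (1 + of_int \<bar>i\<bar>)"

lemma mark_pos_less:
  assumes "a < b"
  shows "mark_pos a < mark_pos b"
proof -
  have bound: "of_int i / (1 + of_int \<bar>i\<bar>) < (1::rat)" for i
    by (simp add: divide_less_eq add_pos_nonneg abs_if)
  have mono: "of_int i / (1 + of_int \<bar>i\<bar>) < (of_int j / (1 + of_int \<bar>j\<bar>) :: rat)" if "i < j" for i j
  proof -
    have "i * (1 + \<bar>j\<bar>) < j * (1 + \<bar>i\<bar>)"
    proof (cases "i \<ge> 0 \<or> j \<le> 0")
      case True
      then show ?thesis using that by (auto simp: algebra_simps abs_if)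
    next
      case False
      then have "i * (1 + \<bar>j\<bar>) < 0" "0 < j * (1 + \<bar>i\<bar>)"
        by (auto simp: mult_less_0_iff)
      then show ?thesis by linarith
    qed
    then have "of_int (i * (1 + \<bar>j\<bar>)) < (of_int (j * (1 + \<bar>i\<bar>)) :: rat)"
      by (simp only: of_int_less_iff)
    then show ?thesis
      by (simp add: divide_less_eq less_divide_eq add_pos_nonneg)
  qed
  show ?thesis
    using assms
  proof (cases a; cases b)
    fix i j assume "a = Minus i" "b = Plus j"
    then show ?thesis
      using bound[of i] bound[of j] unfolding mark_pos.simps \<open>a = Minus i\<close> \<open>b = Plus j\<close> by linarith
  qed (use mono in auto)
qed

definition rat_letter :: "arrow \<times> bool \<Rightarrow> rat" where
  "rat_letter = (\<lambda>(e, s). let (a, b) = Rep_arrow e; l = \<bar>mark_pos a - mark_pos b\<bar>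
     in if s then l else inverse l)"

lemma rat_letter_cancel: "rat_letter (e, s) * rat_letter (e, \<not> s) = 1"
proof -
  obtain a b where ab: "Rep_arrow e = (a, b)" "a \<noteq> b"
    using Rep_arrow[of e] by auto
  then have "mark_pos a \<noteq> mark_pos b"
    by (metis mark_pos_less neq_iff)
  then show ?thesis by (simp add: rat_letter_def ab(1) Let_def)
qed

lift_definition rat_group :: "arrow free_group \<Rightarrow> rat" is "\<lambda>w. prod_list (map rat_letter w)"
  by (rule prod_list_pres_eq) (assumption, rule rat_letter_cancel, simp)

interpretation rat_point: lin_ext_hom "\<lambda>q::rat. q" rat_group
  by unfold_locales (simp_all | (transfer, simp))+

lemma one_notin_strip_ideal: "1 \<notin> strip_ideal"
proof
  assume one: "1 \<in> strip_ideal"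
  define ev where "ev = lin_ext (\<lambda>q::rat. q) rat_group"
  have ev_hom: "ev (p + q) = ev p + ev q" "ev (p - q) = ev p - ev q" "ev (p * q) = ev p * ev q"
    "ev (- p) = - ev p" "ev 0 = 0" for p q
    by (simp_all add: ev_def rat_point.lin_ext_add rat_point.lin_ext_minus rat_point.lin_ext_mult
        rat_point.lin_ext_uminus rat_point.lin_ext_zero)
  have fx: "ev (fx a b) = \<bar>mark_pos a - mark_pos b\<bar>"
      "ev (fx_inv a b) = inverse \<bar>mark_pos a - mark_pos b\<bar>" if "a \<noteq> b" for a b
  proof -
    have "rat_group (free_gen e) = rat_letter (e, True)" for e
      by transfer simp
    moreover have "rat_group (- free_gen e) = rat_letter (e, False)" for e
      by transfer (simp add: word_inv_def)
    ultimately show "ev (fx a b) = \<bar>mark_pos a - mark_pos b\<bar>"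
      "ev (fx_inv a b) = inverse \<bar>mark_pos a - mark_pos b\<bar>"
      using that
      by (simp_all add: ev_def fx_def fx_inv_def rat_point.lin_ext_single rat_letter_def Abs_arrow_inverse)
  qed
  have "ideal {p. ev p = 0} (ring_of_type_algebra :: free_alg ring)"
  proof (rule idealI[OF ring_ring_of_type_algebra])
    interpret ring "ring_of_type_algebra :: free_alg ring"
      by (rule ring_ring_of_type_algebra)
    show "subgroup {p. ev p = 0} (add_monoid (ring_of_type_algebra :: free_alg ring))"
    proof (rule add.subgroupI)
      fix p assume "p \<in> {p. ev p = 0}"
      moreover have "\<ominus>\<^bsub>ring_of_type_algebra\<^esub> p = - p"
        by (rule minus_equality) (auto simp: ring_of_type_algebra_def)
      ultimately show "\<ominus>\<^bsub>ring_of_type_algebra\<^esub> p \<in> {p. ev p = 0}"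
        by (simp add: ev_hom)
    qed (auto simp: ring_of_type_algebra_def ev_hom intro: exI[of _ 0])
  qed (auto simp: ring_of_type_algebra_def ev_hom)
  moreover have "strip_rels \<subseteq> {p. ev p = 0}"
  proof -
    have "ev (fx b d) = ev (fx b c * fx_inv a c * fx a d + fx b a * fx_inv c a * fx c d)"
      if cyc: "cyclic_seq [a, b, c, d]" for a b c d
    proof -
      have d: "distinct [a, b, c, d]" using cyc by (simp add: cyclic_seq_def)
      have "mark_pos a \<noteq> mark_pos c"
        using d by (metis distinct_length_2_or_more mark_pos_less neq_iff)
      moreover have "\<bar>mark_pos b - mark_pos d\<bar> * \<bar>mark_pos a - mark_pos c\<bar> =
          \<bar>mark_pos b - mark_pos c\<bar> * \<bar>mark_pos a - mark_pos d\<bar> +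
          \<bar>mark_pos b - mark_pos a\<bar> * \<bar>mark_pos c - mark_pos d\<bar>"
        using cyc
        by (rule cyclic_seq4_cases) (auto dest!: mark_pos_less simp: abs_if algebra_simps)
      moreover have "y = p * inverse t * q + r * inverse t * u"
        if "t \<noteq> 0" "y * t = p * q + r * u" for y t p q r u :: rat
        using that by (simp add: field_simps)
      moreover have "ev (fx_inv c a) = inverse \<bar>mark_pos a - mark_pos c\<bar>"
        using d fx(2)[of c a] by (auto simp: abs_minus_commute)
      ultimately show ?thesis
        using d by (auto simp: ev_hom fx)
    qed
    then show ?thesis
      by (auto simp: strip_rels_def ev_hom fx abs_minus_commute)
  qed
  ultimately have "strip_ideal \<subseteq> {p. ev p = 0}"
    unfolding strip_ideal_def by (rule ring.genideal_minimal[OF ring_ring_of_type_algebra])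
  with one have "ev 1 = 0" by auto
  then show False by (simp add: ev_def rat_point.lin_ext_one)
qed

quotient_type strip_alg = free_alg / "\<lambda>p q. p - q \<in> strip_ideal"
proof (intro equivpI reflpI sympI transpI)
  fix p q r :: free_alg
  show "p - p \<in> strip_ideal" by (simp add: strip_ideal_zero)
  show "q - p \<in> strip_ideal" if "p - q \<in> strip_ideal"
    using strip_ideal_uminus[OF that] by simp
  show "p - r \<in> strip_ideal" if "p - q \<in> strip_ideal" "q - r \<in> strip_ideal"
    using strip_ideal_add[OF that] by simp
qed

instantiation strip_alg :: ring_1
begin

lift_definition zero_strip_alg :: strip_alg is 0 .

lift_definition one_strip_alg :: strip_alg is 1 .

lift_definition plus_strip_alg :: "strip_alg \<Rightarrow> strip_alg \<Rightarrow> strip_alg" is "(+)"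
  by (drule (1) strip_ideal_add) (simp add: algebra_simps)

lift_definition uminus_strip_alg :: "strip_alg \<Rightarrow> strip_alg" is uminus
  by (drule strip_ideal_uminus) simp

lift_definition minus_strip_alg :: "strip_alg \<Rightarrow> strip_alg \<Rightarrow> strip_alg" is "(-)"
  by (drule (1) strip_ideal_minus) (simp add: algebra_simps)

lift_definition times_strip_alg :: "strip_alg \<Rightarrow> strip_alg \<Rightarrow> strip_alg" is "(*)"
proof -
  fix p p' q q' :: free_alg
  assume "p - p' \<in> strip_ideal" "q - q' \<in> strip_ideal"
  then have "(p - p') * q + p' * (q - q') \<in> strip_ideal"
    by (intro strip_ideal_add strip_ideal_mult_left strip_ideal_mult_right)
  then show "p * q - p' * q' \<in> strip_ideal" by (simp add: algebra_simps)
qed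

instance
proof
  show "(0::strip_alg) \<noteq> 1"
  proof transfer
    show "0 - 1 \<notin> strip_ideal"
      using one_notin_strip_ideal strip_ideal_uminus[of "- 1"] by auto
  qed
  fix a b c :: strip_alg
  show "a + b + c = a + (b + c)" by transfer (simp add: strip_ideal_zero add.assoc)
  show "a + b = b + a" by transfer (simp add: strip_ideal_zero add.commute)
  show "0 + a = a" by transfer (simp add: strip_ideal_zero)
  show "- a + a = 0" by transfer (simp add: strip_ideal_zero)
  show "a - b = a + - b" by transfer (simp add: strip_ideal_zero)
  show "a * b * c = a * (b * c)" by transfer (simp add: strip_ideal_zero mult.assoc)
  show "1 * a = a" by transfer (simp add: strip_ideal_zero)
  show "a * 1 = a" by transfer (simp add: strip_ideal_zero)
  show "(a + b) * c = a * c + b * c" by transfer (simp add: strip_ideal_zero distrib_right)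
  show "a * (b + c) = a * b + a * c" by transfer (simp add: strip_ideal_zero distrib_left)
qed

end

text \<open>For \<open>a = b\<close> the following two are junk, which no relation uses.\<close>

lift_definition gen_x :: "mark \<Rightarrow> mark \<Rightarrow> strip_alg" is fx .

lift_definition gen_x_inv :: "mark \<Rightarrow> mark \<Rightarrow> strip_alg" is fx_inv .

abbreviation unit_inv :: "'a::ring_1 \<Rightarrow> 'a" where
  "unit_inv \<equiv> m_inv ring_of_type_algebra"

lemma unit_inv_eqI:
  fixes u v :: "'a::ring_1"
  assumes "u * v = 1" "v * u = 1"
  shows "unit_inv u = v"
  unfolding m_inv_def
proof (rule the_equality)
  show "v \<in> carrier ring_of_type_algebra \<and> u \<otimes>\<^bsub>ring_of_type_algebra\<^esub> v = \<one>\<^bsub>ring_of_type_algebra\<^esub>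
    \<and> v \<otimes>\<^bsub>ring_of_type_algebra\<^esub> u = \<one>\<^bsub>ring_of_type_algebra\<^esub>"
    using assms by (simp add: ring_of_type_algebra_def)
next
  fix w
  assume "w \<in> carrier ring_of_type_algebra \<and> u \<otimes>\<^bsub>ring_of_type_algebra\<^esub> w = \<one>\<^bsub>ring_of_type_algebra\<^esub>
    \<and> w \<otimes>\<^bsub>ring_of_type_algebra\<^esub> u = \<one>\<^bsub>ring_of_type_algebra\<^esub>"
  then have "w * u = 1" by (simp add: ring_of_type_algebra_def)
  with assms show "w = v" by (metis mult.assoc mult_1 mult.right_neutral)
qed

lemma
  shows gen_x_right_inv: "gen_x a b * gen_x_inv a b = 1"
    and gen_x_left_inv: "gen_x_inv a b * gen_x a b = 1"
  by (transfer, simp add: fx_def fx_inv_def mult_single strip_ideal_zero)+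

lemma unit_inv_gen_x: "unit_inv (gen_x a b) = gen_x_inv a b"
  by (rule unit_inv_eqI) (rule gen_x_right_inv gen_x_left_inv)+

lemma gen_x_triangle:
  assumes "distinct [a, b, c]"
  shows "gen_x a b * gen_x_inv c b * gen_x c a = gen_x a c * gen_x_inv b c * gen_x b a"
proof -
  have "fx a b * fx_inv c b * fx c a - fx a c * fx_inv b c * fx b a \<in> strip_rels"
    using assms unfolding strip_rels_def by blast
  with strip_rels_ideal
  have "fx a b * fx_inv c b * fx c a - fx a c * fx_inv b c * fx b a \<in> strip_ideal" ..
  then show ?thesis by transfer
qed

lemma gen_x_exchange:
  assumes "cyclic_seq [a, b, c, d]"
  shows "gen_x b d = gen_x b c * gen_x_inv a c * gen_x a d + gen_x b a * gen_x_inv c a * gen_x c d"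
proof -
  have "fx b d - (fx b c * fx_inv a c * fx a d + fx b a * fx_inv c a * fx c d) \<in> strip_rels"
    using assms unfolding strip_rels_def by blast
  with strip_rels_ideal
  have "fx b d - (fx b c * fx_inv a c * fx a d + fx b a * fx_inv c a * fx c d) \<in> strip_ideal" ..
  then show ?thesis by transfer
qed

definition triangulation :: "(mark \<times> mark) set" where
  "triangulation = (\<Union>i.
     {(Minus i, Minus (i + 1)), (Plus i, Plus (i + 1)),
      (Minus (i + 1), Minus i), (Plus (i + 1), Plus i),
      (Minus i, Plus i), (Plus i, Minus i),
      (Minus i, Plus (i + 1)), (Plus (i + 1), Minus i)})"

lemma triangulation_neq: "(a, b) \<in> triangulation \<Longrightarrow> a \<noteq> b"
  by (auto simp: triangulation_def)

lemma triangulation_sym: "(a, b) \<in> triangulation \<Longrightarrow> (b, a) \<in> triangulation"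
  unfolding triangulation_def by blast

typedef tri_arrow = triangulation
  unfolding triangulation_def by blast

definition triangle_rels :: "(tri_arrow word \<times> tri_arrow word) set" where
  "triangle_rels = (let t = (\<lambda>a b. (Abs_tri_arrow (a, b), True));
       t_inv = (\<lambda>a b. (Abs_tri_arrow (a, b), False))
     in {([t a b, t_inv c b, t c a], [t a c, t_inv b c, t b a]) | a b c.
          distinct [a, b, c] \<and> {(a, b), (b, c), (c, a)} \<subseteq> triangulation})"

quotient_type tri_group = "tri_arrow word" / "pres_eq triangle_rels"
  by (rule equivp_pres_eq)

instantiation tri_group :: group_add
begin

lift_definition zero_tri_group :: tri_group is "[]" .

lift_definition plus_tri_group :: "tri_group \<Rightarrow> tri_group \<Rightarrow> tri_group" is "(@)"
  by (rule pres_eq_append)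

lift_definition uminus_tri_group :: "tri_group \<Rightarrow> tri_group" is word_inv
  by (rule pres_eq_word_inv)

definition minus_tri_group :: "tri_group \<Rightarrow> tri_group \<Rightarrow> tri_group" where
  "minus_tri_group a b = a + - b"

instance
  by intro_classes
    (simp add: minus_tri_group_def | transfer, simp add: pres_refl word_inv_left)+

end

type_synonym tri_ring = "tri_group \<Rightarrow>\<^sub>0 int"

lift_definition tri_gen :: "mark \<Rightarrow> mark \<Rightarrow> tri_group" is "\<lambda>a b. [(Abs_tri_arrow (a, b), True)]" .

definition tri_letter :: "tri_arrow \<times> bool \<Rightarrow> strip_alg" where
  "tri_letter = (\<lambda>(e, s). let (a, b) = Rep_tri_arrow e in if s then gen_x a b else gen_x_inv a b)"

lemma tri_letter_cancel: "tri_letter (e, s) * tri_letter (e, \<not> s) = 1"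
  by (cases "Rep_tri_arrow e"; cases s)
    (simp_all add: tri_letter_def gen_x_right_inv gen_x_left_inv)

lemma tri_letter_Abs:
  assumes "(a, b) \<in> triangulation"
  shows "tri_letter (Abs_tri_arrow (a, b), s) = (if s then gen_x a b else gen_x_inv a b)"
  using assms by (simp add: tri_letter_def Abs_tri_arrow_inverse)

lift_definition tri_group_to_alg :: "tri_group \<Rightarrow> strip_alg"
  is "\<lambda>w. prod_list (map tri_letter w)"
proof (rule prod_list_pres_eq)
  fix r r' assume "(r, r') \<in> triangle_rels"
  then obtain a b c where abc: "distinct [a, b, c]" "{(a, b), (b, c), (c, a)} \<subseteq> triangulation"
    and r: "r = [(Abs_tri_arrow (a, b), True), (Abs_tri_arrow (c, b), False), (Abs_tri_arrow (c, a), True)]"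
      "r' = [(Abs_tri_arrow (a, c), True), (Abs_tri_arrow (b, c), False), (Abs_tri_arrow (b, a), True)]"
    unfolding triangle_rels_def Let_def by blast
  then have "(a, b) \<in> triangulation" "(b, a) \<in> triangulation" "(b, c) \<in> triangulation"
    "(c, b) \<in> triangulation" "(c, a) \<in> triangulation" "(a, c) \<in> triangulation"
    by (auto intro: triangulation_sym)
  with gen_x_triangle[OF abc(1)]
  show "prod_list (map tri_letter r) = prod_list (map tri_letter r')"
    by (simp add: r tri_letter_Abs mult.assoc)
qed (assumption, rule tri_letter_cancel)

text \<open>The homomorphism from the group ring to the algebra with \<open>t\<^bsub>ab\<^esub> \<mapsto> x\<^bsub>ab\<^esub>\<close>.\<close>

definition tri_incl :: "tri_ring \<Rightarrow> strip_alg" where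
  "tri_incl = lin_ext of_int tri_group_to_alg"

interpretation tri_incl: lin_ext_hom "of_int :: int \<Rightarrow> strip_alg" tri_group_to_alg
proof
  show "tri_group_to_alg 0 = 1"
    by (simp add: zero_tri_group_def tri_group_to_alg.abs_eq)
  show "tri_group_to_alg (g + h) = tri_group_to_alg g * tri_group_to_alg h" for g h
    by (induct g rule: tri_group.abs_induct, induct h rule: tri_group.abs_induct)
      (simp add: plus_tri_group.abs_eq tri_group_to_alg.abs_eq)
  show "of_int a * y = y * of_int a" for a and y :: strip_alg
    by (rule mult_of_int_commute)
qed simp_all

lemma tri_incl_hom:
  "tri_incl (p + q) = tri_incl p + tri_incl q" "tri_incl (p * q) = tri_incl p * tri_incl q"
  "tri_incl 1 = 1"
  by (simp_all add: tri_incl_def tri_incl.lin_ext_add tri_incl.lin_ext_mult tri_incl.lin_ext_one)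

lemma tri_incl_gen:
  assumes "(a, b) \<in> triangulation"
  shows "tri_incl (Poly_Mapping.single (tri_gen a b) 1) = gen_x a b"
proof -
  have "tri_group_to_alg (tri_gen a b) = tri_letter (Abs_tri_arrow (a, b), True)" for a b
    by (simp add: tri_group_to_alg.abs_eq tri_gen.abs_eq)
  then show ?thesis
    using assms by (simp add: tri_incl_def tri_incl.lin_ext_single tri_letter_Abs)
qed

definition U_el :: "int \<Rightarrow> int \<Rightarrow> strip_alg" where
  "U_el i j = gen_x (Minus i) (Plus j)"

definition V_el :: "int \<Rightarrow> int \<Rightarrow> strip_alg" where
  "V_el i j = gen_x (Plus i) (Minus j)"

definition A_el :: "int \<Rightarrow> strip_alg" where
  "A_el j = unit_inv (gen_x (Plus (j + 1)) (Plus j))"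

definition A_bar :: "int \<Rightarrow> strip_alg" where
  "A_bar j = unit_inv (gen_x (Plus j) (Plus (j + 1)))"

definition B_el :: "int \<Rightarrow> strip_alg" where
  "B_el j = unit_inv (gen_x (Minus (j + 1)) (Minus j))"

definition B_bar :: "int \<Rightarrow> strip_alg" where
  "B_bar j = unit_inv (gen_x (Minus j) (Minus (j + 1)))"

text \<open>
  The element of the skew field of fractions given by an element of the algebra that lies in the
  group ring, where the latter is a subring of the algebra via \<^const>\<open>tri_incl\<close> and of the
  skew field via \<open>\<iota>\<close>.
\<close>

definition in_frac :: "(tri_ring \<Rightarrow> 'k) \<Rightarrow> strip_alg \<Rightarrow> 'k" where
  "in_frac \<iota> y = \<iota> (the_inv tri_incl y)"

definition H_plus :: "(tri_ring \<Rightarrow> 'k::division_ring) \<Rightarrow> int \<Rightarrow> int \<Rightarrow> 'k" where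
  "H_plus \<iota> i j = inverse (in_frac \<iota> (U_el j i)) *
     (in_frac \<iota> (U_el j (i - 1)) * in_frac \<iota> (A_el (i - 1)) +
      in_frac \<iota> (U_el j (i + 1)) * in_frac \<iota> (A_bar i))"

definition H_minus :: "(tri_ring \<Rightarrow> 'k::division_ring) \<Rightarrow> int \<Rightarrow> int \<Rightarrow> 'k" where
  "H_minus \<iota> i j = inverse (in_frac \<iota> (V_el j i)) *
     (in_frac \<iota> (V_el j (i - 1)) * in_frac \<iota> (B_el (i - 1)) +
      in_frac \<iota> (V_el j (i + 1)) * in_frac \<iota> (B_bar i))"

end

theory Submission
  imports Defs
begin

text \<open>
  List the marked points in zigzag order \<open>\<dots>, i\<^sub>+, i\<^sub>-, (i+1)\<^sub>+, (i+1)\<^sub>-, \<dots>\<close>; the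
  triangulation then joins exactly the points at distance one or two.  After attaching signs to the
  generators, the triangle and exchange relations become a single four-term Pluecker relation, a
  special case of which is a second-order linear recurrence along the zigzag, with coefficients
  that are units of the group ring.  Solving this recurrence in the group ring gives preimages of
  all generators, hence the membership claims.

  In a skew field that contains the group ring, the solutions \<open>P k\<close> of the recurrence with
  \<open>P k k = 0\<close> and nonzero other entries satisfy the Pluecker relation again.  So the embedding of the
  group ring into its field of fractions factors through the algebra; in particular the group ring
  embeds into the algebra, and identities of the algebra may be transported to the skew field.
  There \<open>H\<^sup>+\<close> and \<open>H\<^sup>-\<close> are noncommutative angles \<open>x\<^bsub>pq\<^esub>\<^sup>-\<^sup>1x\<^bsub>pr\<^esub>x\<^bsub>qr\<^esub>\<^sup>-\<^sup>1\<close>, with \<open>p, q, r\<close> three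
  consecutive points on one boundary line: this is additivity of the angle at \<open>q\<close>.
\<close>

section \<open>Second-order linear recurrences\<close>

text \<open>Upwards the sequence is iterated; downwards a preimage is chosen at each step, which is
  where surjectivity enters.\<close>

lemma int_sequence_exists:
  fixes T :: "int \<Rightarrow> 'a \<Rightarrow> 'a"
  assumes "\<And>k. surj (T k)"
  shows "\<exists>s. s k = a \<and> (\<forall>l. s (l + 1) = T l (s l))"
proof -
  define up where "up = rec_nat a (\<lambda>n. T (k + int n))"
  \<comment> \<open>\<open>dn n\<close> is the value at \<open>k - n\<close>, so the next one is a
    preimage under the map with index \<open>k - n - 1\<close>.\<close>
  define dn where "dn = rec_nat a (\<lambda>n. inv_into UNIV (T (k - int n - 1)))"
  define s where "s l = (if k \<le> l then up (nat (l - k)) else dn (nat (k - l)))" for l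
  have "s (l + 1) = T l (s l)" for l
  proof (cases "k \<le> l")
    case True
    then have "nat (l + 1 - k) = Suc (nat (l - k))" by simp
    with True show ?thesis by (simp add: s_def up_def)
  next
    case False
    define n where "n = nat (k - l - 1)"
    have n: "nat (k - l) = Suc n" "l = k - int n - 1" "nat (k - (l + 1)) = n"
      using False by (auto simp: n_def)
    have "s (l + 1) = dn n"
      using n False by (cases n) (simp_all add: s_def up_def dn_def)
    moreover have "s l = inv_into UNIV (T l) (dn n)"
      using n False by (simp add: s_def dn_def)
    ultimately show ?thesis
      using assms by (simp add: surj_f_inv_f)
  qed
  moreover have "s k = a" by (simp add: s_def up_def)
  ultimately show ?thesis by blast
qed

text \<open>The coefficients act from the right, so the solutions form a left module.\<close>

definition solves :: "(int \<Rightarrow> 'r) \<Rightarrow> (int \<Rightarrow> 'r) \<Rightarrow> (int \<Rightarrow> 'r::ring_1) \<Rightarrow> bool" where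
  "solves C D u \<longleftrightarrow> (\<forall>l. u (l + 2) = u (l + 1) * C l + u l * D l)"

text \<open>Pairs of consecutive values obey a first-order recurrence, and a left inverse of
  \<open>D l\<close> makes its step maps surjective.\<close>

lemma solves_exists:
  fixes C D E :: "int \<Rightarrow> 'r::ring_1"
  assumes E: "\<And>l. E l * D l = 1"
  shows "\<exists>u. solves C D u \<and> u k = a \<and> u (k + 1) = b"
proof -
  define T where "T l = (\<lambda>(x, y). (y, y * C l + x * D l))" for l
  have "T l ((z - y * C l) * E l, y) = (y, z)" for l y z
    by (simp add: T_def mult.assoc E)
  then have "surj (T l)" for l
    by (metis surj_def surj_pair)
  from int_sequence_exists[of T k "(a, b)", OF this] obtain s
    where s: "s k = (a, b)" "\<And>l. s (l + 1) = T l (s l)" by blast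
  define u where "u l = fst (s l)" for l
  have snd: "snd (s l) = u (l + 1)" for l
    using s(2)[of l] by (simp add: u_def T_def split_beta)
  have "u (l + 2) = u (l + 1) * C l + u l * D l" for l
  proof -
    have "u (l + 2) = snd (s (l + 1))" using snd[of "l + 1"] by (simp add: add.assoc)
    also have "\<dots> = snd (s l) * C l + fst (s l) * D l"
      by (simp add: s(2) T_def split_beta)
    finally show ?thesis by (simp add: snd u_def)
  qed
  moreover have "u k = a" "u (k + 1) = b"
    using s(1) snd[of k] by (simp_all add: u_def)
  ultimately show ?thesis
    unfolding solves_def by blast
qed

text \<open>Downwards the recurrence yields only \<open>u (i - 1) * D (i - 1) = 0\<close>; the right
  inverse of \<open>D\<close> cancels the coefficient.\<close>

lemma solves_eq_zero:
  fixes C D E :: "int \<Rightarrow> 'r::ring_1"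
  assumes E: "\<And>l. D l * E l = 1" and u: "solves C D u" and "u k = 0" "u (k + 1) = 0"
  shows "u l = 0"
proof -
  have "u l = 0 \<and> u (l + 1) = 0"
  proof (induction l rule: int_induct[where k = k])
    case base
    show ?case using assms by simp
  next
    case (step1 i)
    then show ?case using u[unfolded solves_def, rule_format, of i] by (simp add: add.assoc)
  next
    case (step2 i)
    then have "u (i - 1) * D (i - 1) = 0"
      using u[unfolded solves_def, rule_format, of "i - 1"] by (simp add: algebra_simps)
    then have "u (i - 1) * D (i - 1) * E (i - 1) = 0" by simp
    with step2 show ?case by (simp add: E mult.assoc)
  qed
  then show ?thesis ..
qed

lemma solves_diff: "solves C D u \<Longrightarrow> solves C D v \<Longrightarrow> solves C D (\<lambda>l. u l - v l)"
  by (simp add: solves_def algebra_simps)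

lemma solves_mult_left: "solves C D u \<Longrightarrow> solves C D (\<lambda>l. r * u l)"
  by (simp add: solves_def algebra_simps)

lemma solves_unique:
  fixes C D E :: "int \<Rightarrow> 'r::ring_1"
  assumes "\<And>l. D l * E l = 1" "solves C D u" "solves C D v" "u k = v k" "u (k + 1) = v (k + 1)"
  shows "u l = v l"
  using solves_eq_zero[OF assms(1) solves_diff[OF assms(2,3)], of k l] assms(4,5) by simp

text \<open>
  Both sides solve the recurrence and agree at the places \<open>a\<close> and \<open>b\<close>.  A solution that vanishes
  at \<open>a\<close> is a left multiple of \<open>P a\<close>, so it is zero if it also vanishes at \<open>b\<close>.
\<close>

lemma solves_pluecker:
  fixes P :: "int \<Rightarrow> int \<Rightarrow> 'k::division_ring"
  assumes D: "\<And>l. D l \<noteq> 0" and P: "\<And>k. solves C D (P k)" "\<And>k. P k k = 0"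
    "\<And>k l. k \<noteq> l \<Longrightarrow> P k l \<noteq> 0" and "a \<noteq> b"
  shows "P c d = P c b * inverse (P a b) * P a d + P c a * inverse (P b a) * P b d"
proof -
  have E: "D l * inverse (D l) = 1" for l using D by simp
  define u where "u l = P c l - P c b * inverse (P a b) * P a l - P c a * inverse (P b a) * P b l" for l
  \<comment> \<open>Both \<open>u\<close> and \<open>P a\<close> vanish at \<open>a\<close>, so the
    factor is read off at \<open>a + 1\<close>, where \<open>P a\<close> is nonzero.\<close>
  define r where "r = u (a + 1) * inverse (P a (a + 1))"
  have u: "solves C D u"
    unfolding u_def by (intro solves_diff solves_mult_left P)
  have ua: "u a = 0" and ub: "u b = 0"
    using \<open>a \<noteq> b\<close> P by (simp_all add: u_def mult.assoc)
  have ur: "u l = r * P a l" for l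
    by (rule solves_unique[OF E u solves_mult_left[OF P(1)], of a])
      (use P(3)[of a "a + 1"] in \<open>simp_all add: ua P(2) r_def mult.assoc\<close>)
  with ub \<open>a \<noteq> b\<close> P(3)[of a b] have "r = 0" by simp
  with ur[of d] show ?thesis by (simp add: u_def algebra_simps)
qed

section \<open>The Pluecker relation in the strip algebra\<close>

text \<open>Polymorphic, because the same signs occur in the algebra, the group ring and the skew
  field.\<close>

definition mark_sgn :: "mark \<Rightarrow> mark \<Rightarrow> 'r::ring_1" where
  "mark_sgn a b = (if a < b then 1 else if b < a then - 1 else 0)"

lemma mark_sgn_self [simp]: "mark_sgn a a = 0"
  by (simp add: mark_sgn_def)

lemma mark_sgn_less: "a < b \<Longrightarrow> mark_sgn a b = 1" "a < b \<Longrightarrow> mark_sgn b a = - 1"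
  by (auto simp: mark_sgn_def)

lemma mark_sgn_square: "a \<noteq> b \<Longrightarrow> mark_sgn a b * mark_sgn a b = 1"
  by (auto simp: mark_sgn_def)

text \<open>Since \<open>gen_x a a\<close> is a unit, it is the sign zero that makes the diagonal
  vanish.\<close>

definition sx :: "mark \<Rightarrow> mark \<Rightarrow> strip_alg" where
  "sx a b = mark_sgn a b * gen_x a b"

definition sy :: "mark \<Rightarrow> mark \<Rightarrow> strip_alg" where
  "sy a b = mark_sgn a b * gen_x_inv a b"

lemma sx_self [simp]: "sx a a = 0"
  by (simp add: sx_def)

lemma
  assumes "a \<noteq> b"
  shows sx_sy: "sx a b * sy a b = 1" and sy_sx: "sy a b * sx a b = 1"
  using assms by (auto simp: sx_def sy_def mark_sgn_def gen_x_right_inv gen_x_left_inv)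

lemma sx_sy_cancel:
  assumes "a \<noteq> b"
  shows "sx a b * (sy a b * y) = y"
  using assms by (simp add: sx_sy flip: mult.assoc)

lemma gen_x_cancel [simp]:
  "gen_x a b * (gen_x_inv a b * y) = y" "gen_x_inv a b * (gen_x a b * y) = y"
  by (simp_all add: mult.assoc[symmetric] gen_x_right_inv gen_x_left_inv)

lemma gen_x_nonzero: "gen_x a b \<noteq> 0"
  using gen_x_right_inv[of a b] by force

text \<open>Each of the three pairs is reversed on the other side, so the signs differ by
  (-1)^3.\<close>

lemma sx_triangle:
  assumes "distinct [a, b, c]"
  shows "sx a b * sy c b * sx c a = - (sx a c * sy b c * sx b a)"
  using assms gen_x_triangle[OF assms] by (auto simp: sx_def sy_def mark_sgn_def)

lemma cyclic_seq4I:
  assumes "a < b \<and> b < c \<and> c < d \<or> b < c \<and> c < d \<and> d < a \<or> c < d \<and> d < a \<and> a < b \<or> d < a \<and> a < b \<and> b < c"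
  shows "cyclic_seq [a, b, c, d]"
proof -
  have rot: "rotate 0 [a, b, c, d] = [a, b, c, d]" "rotate 1 [a, b, c, d] = [b, c, d, a]"
    "rotate 2 [a, b, c, d] = [c, d, a, b]" "rotate 3 [a, b, c, d] = [d, a, b, c]"
    by (simp_all add: rotate_def numeral_2_eq_2 numeral_3_eq_3)
  have "sorted_wrt (<) (rotate 0 [a, b, c, d]) \<or> sorted_wrt (<) (rotate 1 [a, b, c, d]) \<or>
      sorted_wrt (<) (rotate 2 [a, b, c, d]) \<or> sorted_wrt (<) (rotate 3 [a, b, c, d])"
    unfolding rot using assms by (elim disjE) auto
  then have "\<exists>n. sorted_wrt (<) (rotate n [a, b, c, d])" by blast
  moreover have "distinct [a, b, c, d]"
    using assms by (elim disjE) auto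
  ultimately show ?thesis by (simp add: cyclic_seq_def)
qed
text \<open>Rotating \<open>d\<close> to the last place leaves the six orders of \<open>a\<close>,
  \<open>b\<close>, \<open>c\<close>.\<close>

lemma distinct_cyclic_seq4:
  assumes "distinct [a, b, c, d]"
  shows "cyclic_seq [a, c, b, d] \<or> cyclic_seq [b, c, a, d] \<or> cyclic_seq [a, b, c, d] \<or>
    cyclic_seq [c, b, a, d] \<or> cyclic_seq [b, a, c, d] \<or> cyclic_seq [c, a, b, d]"
  \<comment> \<open>With these instances of linearity and transitivity the claim is propositional in
    the comparisons.\<close>
  using cyclic_seq4I[of a c b d] cyclic_seq4I[of b c a d] cyclic_seq4I[of a b c d]
    cyclic_seq4I[of c b a d] cyclic_seq4I[of b a c d] cyclic_seq4I[of c a b d]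
    less_linear[of a b] less_linear[of a c] less_linear[of b c]
    less_linear[of a d] less_linear[of b d] less_linear[of c d]
    less_trans[of a b c] less_trans[of a c b] less_trans[of b a c]
    less_trans[of b c a] less_trans[of c a b] less_trans[of c b a]
    assms
  by (simp only: distinct.simps list.set insert_iff empty_iff de_Morgan_disj) satx

text \<open>In each of the four rotations both products on the right carry the same sign as
  \<open>sx c d\<close>.\<close>

lemma sx_exchange:
  assumes "cyclic_seq [a, c, b, d]"
  shows "sx c d = sx c b * sy a b * sx a d + sx c a * sy b a * sx b d"
  using assms
proof (rule cyclic_seq4_cases)
  assume "a < c" "c < b" "b < d"
  then have "a < b" "a < d" "c < d" by order+
  with \<open>a < c\<close> \<open>c < b\<close> \<open>b < d\<close> show ?thesis
    by (simp add: sx_def sy_def mark_sgn_less gen_x_exchange[OF assms])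
next
  assume "c < b" "b < d" "d < a"
  then have "c < d" "c < a" "b < a" by order+
  with \<open>c < b\<close> \<open>b < d\<close> \<open>d < a\<close> show ?thesis
    by (simp add: sx_def sy_def mark_sgn_less gen_x_exchange[OF assms])
next
  assume "b < d" "d < a" "a < c"
  then have "b < a" "b < c" "d < c" by order+
  with \<open>b < d\<close> \<open>d < a\<close> \<open>a < c\<close> show ?thesis
    by (simp add: sx_def sy_def mark_sgn_less gen_x_exchange[OF assms])
next
  assume "d < a" "a < c" "c < b"
  then have "d < c" "d < b" "a < b" by order+
  with \<open>d < a\<close> \<open>a < c\<close> \<open>c < b\<close> show ?thesis
    by (simp add: sx_def sy_def mark_sgn_less gen_x_exchange[OF assms])
qed

text \<open>The two relations differ by swapping \<open>b\<close> and \<open>c\<close>. Multiplying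
  the given one on the left by \<open>sx c a * sy b a\<close> isolates \<open>sx c d\<close>, and
  the triangle relation simplifies the other term.\<close>

lemma sx_pluecker_flip:
  assumes "distinct [a, b, c]"
    and "sx b d = sx b c * sy a c * sx a d + sx b a * sy c a * sx c d"
  shows "sx c d = sx c b * sy a b * sx a d + sx c a * sy b a * sx b d"
proof -
  have "sx c a * sy b a * sx b d =
    (sx c a * sy b a * sx b c) * sy a c * sx a d + sx c a * (sy b a * sx b a) * sy c a * sx c d"
    unfolding assms(2) by (simp add: distrib_left mult.assoc)
  also have "sx c a * sy b a * sx b c = - (sx c b * sy a b * sx a c)"
    using sx_triangle[of c a b] assms(1) by auto
  also have "- (sx c b * sy a b * sx a c) * sy a c * sx a d = - (sx c b * sy a b * sx a d)"
    using assms(1) by (simp add: sx_sy_cancel mult.assoc)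
  also have "sy b a * sx b a = 1" using assms(1) by (auto intro: sy_sx)
  also have "sx c a * 1 * sy c a = 1" using assms(1) by (auto intro: sx_sy)
  finally show ?thesis by simp
qed

text \<open>The exchange relation applies directly when \<open>ab\<close> and \<open>cd\<close> are
  the diagonals. Otherwise the diagonals are \<open>ac\<close>, \<open>bd\<close> or
  \<open>bc\<close>, \<open>ad\<close>, and the relation for \<open>sx b d\<close> or
  \<open>sx a d\<close> is solved for \<open>sx c d\<close>.\<close>

lemma sx_pluecker:
  assumes "a \<noteq> b"
  shows "sx c d = sx c b * sy a b * sx a d + sx c a * sy b a * sx b d"
proof -
  consider "c = a \<or> c = b \<or> d = a \<or> d = b" | "c = d" "distinct [c, a, b]" | "distinct [a, b, c, d]"
    using assms by fastforce
  then show ?thesis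
  proof cases
    case 1
    then show ?thesis
      using assms by (auto simp: sx_sy sy_sx sx_sy_cancel mult.assoc)
  next
    case 2
    then show ?thesis using sx_triangle[of c a b] by simp
  next
    case 3
    \<comment> \<open>The claim is symmetric in \<open>a\<close> and \<open>b\<close>, which halves
      the six orders.\<close>
    have comm: "sx c d = sx c a * sy b a * sx b d + sx c b * sy a b * sx a d \<Longrightarrow> ?thesis"
      by (simp add: add.commute)
    from distinct_cyclic_seq4[OF 3] show ?thesis
    proof (elim disjE)
      assume "cyclic_seq [a, c, b, d]"
      then show ?thesis by (rule sx_exchange)
    next
      assume "cyclic_seq [b, c, a, d]"
      then show ?thesis by (intro comm sx_exchange)
    next
      assume "cyclic_seq [a, b, c, d]"
      from sx_pluecker_flip[OF _ sx_exchange[OF this]] 3 show ?thesis by auto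
    next
      assume "cyclic_seq [c, b, a, d]"
      from sx_exchange[OF this]
      have "sx b d = sx b c * sy a c * sx a d + sx b a * sy c a * sx c d"
        by (simp add: add.commute)
      from sx_pluecker_flip[OF _ this] 3 show ?thesis by auto
    next
      assume "cyclic_seq [b, a, c, d]"
      from sx_pluecker_flip[OF _ sx_exchange[OF this]] 3 show ?thesis by (auto intro: comm)
    next
      assume "cyclic_seq [c, a, b, d]"
      from sx_exchange[OF this]
      have "sx a d = sx a c * sy b c * sx b d + sx a b * sy c b * sx c d"
        by (simp add: add.commute)
      from sx_pluecker_flip[OF _ this] 3 show ?thesis by (auto intro: comm)
    qed
  qed
qed

section \<open>The recurrence along the zigzag\<close>

definition zig :: "int \<Rightarrow> mark" where
  "zig k = (if even k then Plus (k div 2) else Minus (k div 2))"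

fun zag :: "mark \<Rightarrow> int" where
  "zag (Plus i) = 2 * i"
| "zag (Minus i) = 2 * i + 1"

lemma zig_zag [simp]: "zig (zag a) = a"
  by (cases a) (auto simp: zig_def)

lemma zag_zig [simp]: "zag (zig k) = k"
  by (auto simp: zig_def)

lemma zig_eq_iff [simp]: "zig k = zig l \<longleftrightarrow> k = l"
  by (metis zag_zig)

lemma zag_eq_iff [simp]: "zag a = zag b \<longleftrightarrow> a = b"
  by (metis zig_zag)

lemma triangulation_zig:
  "triangulation = (\<Union>k. {(zig k, zig (k + 1)), (zig (k + 1), zig k), (zig k, zig (k + 2)), (zig (k + 2), zig k)})"
  (is "_ = (\<Union>k. ?Z k)")
proof
  have "{(Minus i, Minus (i + 1)), (Plus i, Plus (i + 1)), (Minus (i + 1), Minus i), (Plus (i + 1), Plus i),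
      (Minus i, Plus i), (Plus i, Minus i), (Minus i, Plus (i + 1)), (Plus (i + 1), Minus i)}
    \<subseteq> ?Z (2 * i) \<union> ?Z (2 * i + 1)" for i
    by (simp add: zig_def)
  then show "triangulation \<subseteq> (\<Union>k. ?Z k)"
    unfolding triangulation_def by blast
  have "?Z k \<subseteq> triangulation" for k
    by (cases "even k"; elim evenE oddE) (auto simp: triangulation_def zig_def)
  then show "(\<Union>k. ?Z k) \<subseteq> triangulation" by blast
qed

text \<open>Neighbours lie on opposite lines, points at distance two on the same line, and the order
  runs backwards on the plus line. Hence the signs depend only on parity, and they cancel in the
  coefficients of the recurrence.\<close>

lemma mark_sgn_zig:
  "mark_sgn (zig k) (zig (k + 1)) = (if even k then - 1 else 1)"
  "mark_sgn (zig (k + 1)) (zig k) = (if even k then 1 else - 1)"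
  "mark_sgn (zig k) (zig (k + 2)) = (if even k then - 1 else 1)"
  "mark_sgn (zig (k + 2)) (zig k) = (if even k then 1 else - 1)"
  "mark_sgn (zig (k + 1)) (zig (k + 2)) = (if even k then 1 else - 1)"
  "mark_sgn (zig (k + 2)) (zig (k + 1)) = (if even k then - 1 else 1)"
  by (cases "even k"; elim evenE oddE; simp add: mark_sgn_def zig_def)+

section \<open>Generators of the group ring\<close>

definition tx :: "mark \<Rightarrow> mark \<Rightarrow> tri_ring" where
  "tx a b = Poly_Mapping.single (tri_gen a b) 1"

definition ty :: "mark \<Rightarrow> mark \<Rightarrow> tri_ring" where
  "ty a b = Poly_Mapping.single (- tri_gen a b) 1"

lemma tx_ty: "tx a b * ty a b = 1" and ty_tx: "ty a b * tx a b = 1"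
  by (simp_all add: tx_def ty_def mult_single)

lemma tx_ty_cancel [simp]: "tx a b * (ty a b * p) = p" "ty a b * (tx a b * p) = p"
  by (simp_all add: mult.assoc[symmetric] tx_ty ty_tx)

lemma tri_incl_tx: "(a, b) \<in> triangulation \<Longrightarrow> tri_incl (tx a b) = gen_x a b"
  by (simp add: tx_def tri_incl_gen)

lemma tri_incl_ty:
  assumes "(a, b) \<in> triangulation"
  shows "tri_incl (ty a b) = gen_x_inv a b"
proof -
  have "tri_incl (tx a b) * tri_incl (ty a b) = 1"
    by (simp add: tx_ty tri_incl_hom flip: tri_incl_hom(2))
  then have "gen_x_inv a b * (gen_x a b * tri_incl (ty a b)) = gen_x_inv a b"
    using assms by (simp add: tri_incl_tx)
  then show ?thesis by simp
qed

lemma tx_triangle: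
  assumes "distinct [a, b, c]" "{(a, b), (b, c), (c, a)} \<subseteq> triangulation"
  shows "tx a b * ty c b * tx c a = tx a c * ty b c * tx b a"
proof -
  have "([(Abs_tri_arrow (a, b), True), (Abs_tri_arrow (c, b), False), (Abs_tri_arrow (c, a), True)],
      [(Abs_tri_arrow (a, c), True), (Abs_tri_arrow (b, c), False), (Abs_tri_arrow (b, a), True)])
    \<in> triangle_rels"
    using assms unfolding triangle_rels_def Let_def by blast
  from pres_rel[OF this, of "[]" "[]"]
  have "tri_gen a b + - tri_gen c b + tri_gen c a = tri_gen a c + - tri_gen b c + tri_gen b a"
    by transfer (simp add: word_inv_def)
  then show ?thesis
    by (simp add: tx_def ty_def mult_single)
qed

text \<open>\<open>zig_C\<close> and \<open>zig_D\<close> are the coefficients in the Pluecker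
  relation for \<open>zig l\<close>, \<open>zig (l + 1)\<close> and \<open>zig (l + 2)\<close>. They
  involve only arrows of the triangulation, so they make sense for \<open>tx\<close> as well as for
  \<open>gen_x\<close>.\<close>

definition zig_C :: "(mark \<Rightarrow> mark \<Rightarrow> 'r::ring_1) \<Rightarrow> (mark \<Rightarrow> mark \<Rightarrow> 'r) \<Rightarrow> int \<Rightarrow> 'r" where
  "zig_C x y l = y (zig l) (zig (l + 1)) * x (zig l) (zig (l + 2))"

definition zig_D :: "(mark \<Rightarrow> mark \<Rightarrow> 'r::ring_1) \<Rightarrow> (mark \<Rightarrow> mark \<Rightarrow> 'r) \<Rightarrow> int \<Rightarrow> 'r" where
  "zig_D x y l = y (zig (l + 1)) (zig l) * x (zig (l + 1)) (zig (l + 2))"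

definition zig_E :: "(mark \<Rightarrow> mark \<Rightarrow> 'r::ring_1) \<Rightarrow> (mark \<Rightarrow> mark \<Rightarrow> 'r) \<Rightarrow> int \<Rightarrow> 'r" where
  "zig_E x y l = y (zig (l + 1)) (zig (l + 2)) * x (zig (l + 1)) (zig l)"

lemma zig_D_E:
  assumes "\<And>a b. x a b * y a b = 1" "\<And>a b. y a b * x a b = 1"
  shows "zig_D x y l * zig_E x y l = 1" "zig_E x y l * zig_D x y l = 1"
proof -
  have "x a b * (y a b * z) = z" "y a b * (x a b * z) = z" for a b z
    by (simp_all add: assms flip: mult.assoc)
  then show "zig_D x y l * zig_E x y l = 1" "zig_E x y l * zig_D x y l = 1"
    by (simp_all add: zig_D_def zig_E_def mult.assoc assms)
qed

lemma solves_sx: "solves (zig_C gen_x gen_x_inv) (zig_D gen_x gen_x_inv) (\<lambda>l. sx a (zig l))"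
  unfolding solves_def
proof
  fix l
  have "sy (zig l) (zig (l + 1)) * sx (zig l) (zig (l + 2)) = zig_C gen_x gen_x_inv l"
    "sy (zig (l + 1)) (zig l) * sx (zig (l + 1)) (zig (l + 2)) = zig_D gen_x gen_x_inv l"
    by (simp_all add: sx_def sy_def zig_C_def zig_D_def mark_sgn_zig)
  with sx_pluecker[of "zig l" "zig (l + 1)" a "zig (l + 2)"]
  show "sx a (zig (l + 2)) = sx a (zig (l + 1)) * zig_C gen_x gen_x_inv l +
      sx a (zig l) * zig_D gen_x gen_x_inv l"
    by (simp add: mult.assoc)
qed

section \<open>Solutions of the recurrence in the group ring\<close>

definition frieze :: "int \<Rightarrow> int \<Rightarrow> tri_ring" where
  "frieze k = (SOME u. solves (zig_C tx ty) (zig_D tx ty) u \<and> u k = 0 \<and>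
     u (k + 1) = mark_sgn (zig k) (zig (k + 1)) * tx (zig k) (zig (k + 1)))"

lemma
  shows solves_frieze: "solves (zig_C tx ty) (zig_D tx ty) (frieze k)"
    and frieze_self: "frieze k k = 0"
    and frieze_succ: "frieze k (k + 1) = mark_sgn (zig k) (zig (k + 1)) * tx (zig k) (zig (k + 1))"
proof -
  have "zig_E tx ty l * zig_D tx ty l = 1" for l
    by (intro zig_D_E tx_ty ty_tx)
  from someI_ex[OF solves_exists[OF this]]
  have "solves (zig_C tx ty) (zig_D tx ty) (frieze k) \<and> frieze k k = 0 \<and>
      frieze k (k + 1) = mark_sgn (zig k) (zig (k + 1)) * tx (zig k) (zig (k + 1))"
    unfolding frieze_def .
  then show "solves (zig_C tx ty) (zig_D tx ty) (frieze k)" "frieze k k = 0"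
    "frieze k (k + 1) = mark_sgn (zig k) (zig (k + 1)) * tx (zig k) (zig (k + 1))"
    by blast+
qed

lemma frieze_rec: "frieze k (l + 2) = frieze k (l + 1) * zig_C tx ty l + frieze k l * zig_D tx ty l"
  using solves_frieze[of k] unfolding solves_def by blast

lemma frieze_succ2: "frieze k (k + 2) = mark_sgn (zig k) (zig (k + 2)) * tx (zig k) (zig (k + 2))"
  by (simp add: frieze_rec frieze_self frieze_succ zig_C_def mark_sgn_zig)

text \<open>The middle term of the recurrence at \<open>k\<close> contains
  \<open>frieze (k + 1) (k + 1) = 0\<close>, so one backward step is a multiplication by
  \<open>zig_E\<close>.\<close>

lemma frieze_pred: "frieze (k + 1) k = mark_sgn (zig (k + 1)) (zig k) * tx (zig (k + 1)) (zig k)"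
proof -
  have "frieze (k + 1) (k + 2) = frieze (k + 1) k * zig_D tx ty k"
    using frieze_rec[of "k + 1" k] by (simp add: frieze_self)
  then have "frieze (k + 1) k = frieze (k + 1) (k + 2) * zig_E tx ty k"
    by (simp add: mult.assoc zig_D_E[OF tx_ty ty_tx])
  also have "frieze (k + 1) (k + 2) = mark_sgn (zig (k + 1)) (zig (k + 2)) * tx (zig (k + 1)) (zig (k + 2))"
    using frieze_succ[of "k + 1"] by (simp add: add.assoc)
  finally show ?thesis
    by (simp add: zig_E_def mark_sgn_zig)
qed

text \<open>Here the triangle relation of the group enters; the other entries near the diagonal
  follow from the initial values and the recurrence alone.\<close>

lemma frieze_pred2: "frieze (k + 2) k = mark_sgn (zig (k + 2)) (zig k) * tx (zig (k + 2)) (zig k)"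
proof -
  have "frieze (k + 2) k * zig_D tx ty k = - (frieze (k + 2) (k + 1) * zig_C tx ty k)"
    using frieze_rec[of "k + 2" k] by (simp add: frieze_self eq_neg_iff_add_eq_0 add.commute)
  then have "frieze (k + 2) k * zig_D tx ty k * zig_E tx ty k =
      - (frieze (k + 2) (k + 1) * zig_C tx ty k) * zig_E tx ty k" by simp
  then have "frieze (k + 2) k = - (frieze (k + 2) (k + 1) * zig_C tx ty k) * zig_E tx ty k"
    by (simp add: mult.assoc zig_D_E[OF tx_ty ty_tx])
  also have "frieze (k + 2) (k + 1) = mark_sgn (zig (k + 2)) (zig (k + 1)) * tx (zig (k + 2)) (zig (k + 1))"
    using frieze_pred[of "k + 1"] by (simp add: add.assoc)
  finally have "frieze (k + 2) k = mark_sgn (zig (k + 2)) (zig k) *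
      (tx (zig (k + 2)) (zig (k + 1)) * ty (zig k) (zig (k + 1)) * tx (zig k) (zig (k + 2)) *
       ty (zig (k + 1)) (zig (k + 2)) * tx (zig (k + 1)) (zig k))"
    by (simp add: zig_C_def zig_E_def mark_sgn_zig mult.assoc)
  also have "tx (zig (k + 2)) (zig (k + 1)) * ty (zig k) (zig (k + 1)) * tx (zig k) (zig (k + 2)) =
      tx (zig (k + 2)) (zig k) * ty (zig (k + 1)) (zig k) * tx (zig (k + 1)) (zig (k + 2))"
  proof (rule tx_triangle)
    have "zig (k + 2) = zig (k + 1 + 1)" by (simp add: add.assoc)
    then show "{(zig (k + 2), zig (k + 1)), (zig (k + 1), zig k), (zig k, zig (k + 2))} \<subseteq> triangulation"
      unfolding triangulation_zig by blast
  qed simp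
  finally show ?thesis by (simp add: mult.assoc tx_ty ty_tx)
qed

lemma frieze_zag:
  assumes "(a, b) \<in> triangulation"
  shows "frieze (zag a) (zag b) = mark_sgn a b * tx a b"
  using assms unfolding triangulation_zig
  by (auto simp: frieze_succ frieze_succ2 frieze_pred frieze_pred2)

lemma tri_incl_mark_sgn: "tri_incl (mark_sgn a b) = mark_sgn a b"
  by (simp add: mark_sgn_def tri_incl_def tri_incl.lin_ext_zero tri_incl.lin_ext_one tri_incl.lin_ext_uminus)

text \<open>Both sides solve the same recurrence in the algebra, since \<open>tri_incl\<close>
  carries the coefficients over, and they agree at \<open>k\<close> and
  \<open>k + 1\<close>.\<close>

lemma tri_incl_frieze: "tri_incl (frieze k l) = sx (zig k) (zig l)"
proof (rule solves_unique[where k = k])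
  show "zig_D gen_x gen_x_inv l * zig_E gen_x gen_x_inv l = 1" for l
    by (intro zig_D_E gen_x_right_inv gen_x_left_inv)
  show "solves (zig_C gen_x gen_x_inv) (zig_D gen_x gen_x_inv) (\<lambda>l. sx (zig k) (zig l))"
    by (rule solves_sx)
  have tri: "(zig l, zig (l + 1)) \<in> triangulation" "(zig (l + 1), zig l) \<in> triangulation"
    "(zig l, zig (l + 2)) \<in> triangulation" "(zig (l + 1), zig (l + 2)) \<in> triangulation" for l
  proof -
    have "zig (l + 2) = zig (l + 1 + 1)" by (simp add: add.assoc)
    then show "(zig l, zig (l + 1)) \<in> triangulation" "(zig (l + 1), zig l) \<in> triangulation"
      "(zig l, zig (l + 2)) \<in> triangulation" "(zig (l + 1), zig (l + 2)) \<in> triangulation"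
      unfolding triangulation_zig by blast+
  qed
  then have "tri_incl (zig_C tx ty l) = zig_C gen_x gen_x_inv l"
    "tri_incl (zig_D tx ty l) = zig_D gen_x gen_x_inv l" for l
    by (simp_all add: zig_C_def zig_D_def tri_incl_hom tri_incl_tx tri_incl_ty)
  then show "solves (zig_C gen_x gen_x_inv) (zig_D gen_x gen_x_inv) (\<lambda>l. tri_incl (frieze k l))"
    by (simp add: solves_def frieze_rec tri_incl_hom)
  show "tri_incl (frieze k k) = sx (zig k) (zig k)"
    by (simp add: frieze_self tri_incl_def tri_incl.lin_ext_zero)
  show "tri_incl (frieze k (k + 1)) = sx (zig k) (zig (k + 1))"
    using tri by (simp add: frieze_succ sx_def tri_incl_hom tri_incl_mark_sgn tri_incl_tx)
qed

lemma gen_x_eq_tri_incl: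
  assumes "a \<noteq> b"
  shows "gen_x a b = tri_incl (mark_sgn a b * frieze (zag a) (zag b))"
  by (simp add: tri_incl_hom tri_incl_mark_sgn tri_incl_frieze sx_def mark_sgn_square[OF assms] flip: mult.assoc)

lemma frieze_nonzero:
  assumes "k \<noteq> l"
  shows "frieze k l \<noteq> 0"
proof
  assume "frieze k l = 0"
  then have "gen_x (zig k) (zig l) = 0"
    using gen_x_eq_tri_incl[of "zig k" "zig l"] assms
    by (simp add: tri_incl_def tri_incl.lin_ext_zero)
  then show False using gen_x_nonzero by blast
qed

section \<open>Homomorphisms from the strip algebra to skew fields\<close>

text \<open>The Pluecker relation with both outer points equal to \<open>a\<close> has left side
  zero; the resulting minus sign is absorbed by the signs in \<open>W\<close>.\<close>

lemma skew_pluecker_triangle: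
  fixes Z W :: "mark \<Rightarrow> mark \<Rightarrow> 'k::division_ring"
  assumes Z: "\<And>a b c d. a \<noteq> b \<Longrightarrow>
      Z c d = Z c b * inverse (Z a b) * Z a d + Z c a * inverse (Z b a) * Z b d"
    and "\<And>a. Z a a = 0" and W: "\<And>a b. W a b = mark_sgn a b * Z a b"
    and abc: "distinct [a, b, c]"
  shows "W a b * inverse (W c b) * W c a = W a c * inverse (W b c) * W b a"
proof -
  have "Z a b * inverse (Z c b) * Z c a = - (Z a c * inverse (Z b c) * Z b a)"
    using Z[of b c a a] assms(2)[of a] abc by (simp add: eq_neg_iff_add_eq_0 add.commute)
  moreover have "a < b \<or> b < a" "a < c \<or> c < a" "b < c \<or> c < b"
    using abc by auto
  ultimately show ?thesis
    by (auto simp: W mark_sgn_less)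
qed

lemma skew_pluecker_exchange:
  fixes Z W :: "mark \<Rightarrow> mark \<Rightarrow> 'k::division_ring"
  assumes Z: "\<And>a b c d. a \<noteq> b \<Longrightarrow>
      Z c d = Z c b * inverse (Z a b) * Z a d + Z c a * inverse (Z b a) * Z b d"
    and W: "\<And>a b. W a b = mark_sgn a b * Z a b"
    and abcd: "cyclic_seq [a, b, c, d]"
  shows "W b d = W b c * inverse (W a c) * W a d + W b a * inverse (W c a) * W c d"
proof -
  have ac: "a \<noteq> c" using abcd by (simp add: cyclic_seq_def)
  from abcd show ?thesis
  proof (rule cyclic_seq4_cases)
    assume "a < b" "b < c" "c < d"
    moreover from this have "a < c" "a < d" "b < d" by order+
    ultimately show ?thesis using Z[OF ac, of b d] by (simp add: W mark_sgn_less)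
  next
    assume "b < c" "c < d" "d < a"
    moreover from this have "b < d" "b < a" "c < a" by order+
    ultimately show ?thesis using Z[OF ac, of b d] by (simp add: W mark_sgn_less)
  next
    assume "c < d" "d < a" "a < b"
    moreover from this have "c < a" "c < b" "d < b" by order+
    ultimately show ?thesis using Z[OF ac, of b d] by (simp add: W mark_sgn_less)
  next
    assume "d < a" "a < b" "b < c"
    moreover from this have "d < b" "d < c" "a < c" by order+
    ultimately show ?thesis using Z[OF ac, of b d] by (simp add: W mark_sgn_less)
  qed
qed

text \<open>\<^const>\<open>of_rat\<close> is available only for commutative targets.\<close>

definition rat_embed :: "rat \<Rightarrow> 'k::division_ring" where
  "rat_embed q = of_int (fst (quotient_of q)) * inverse (of_int (snd (quotient_of q)))"

text \<open>Two fractions for \<open>q\<close> cross-multiply to an identity between integers, which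
  can be read in any ring; characteristic zero then cancels the denominator.\<close>

lemma rat_embed_mult_denom:
  assumes char0: "\<And>n::int. n \<noteq> 0 \<Longrightarrow> (of_int n :: 'k::division_ring) \<noteq> 0"
    and q: "b \<noteq> 0" "q * of_int b = of_int a"
  shows "rat_embed q * (of_int b :: 'k) = of_int a"
proof -
  obtain n d where nd: "quotient_of q = (n, d)" by fastforce
  then have d: "d > 0" "q = of_int n / of_int d"
    by (simp_all add: quotient_of_denom_pos quotient_of_div)
  then have "q * of_int d = of_int n" by simp
  then have "of_int n * of_int b = q * of_int b * of_int d" by (simp add: algebra_simps)
  then have "of_int (n * b) = (of_int (a * d) :: rat)" using q by simp
  then have "n * b = a * d" by (simp only: of_int_eq_iff)
  then have *: "(of_int n :: 'k) * of_int b = of_int a * of_int d"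
    by (simp flip: of_int_mult)
  have "inverse (of_int d :: 'k) * of_int b = of_int b * inverse (of_int d)"
    by (rule mult_commute_imp_mult_inverse_commute[OF mult_of_int_commute])
  then have "rat_embed q * (of_int b :: 'k) = of_int n * of_int b * inverse (of_int d)"
    by (simp add: rat_embed_def nd mult.assoc)
  then show ?thesis
    using char0[of d] d by (simp add: * mult.assoc)
qed

text \<open>Clearing any denominator determines the value, so sums and products can be checked
  without reducing fractions.\<close>

lemma rat_embed_eqI:
  assumes char0: "\<And>n::int. n \<noteq> 0 \<Longrightarrow> (of_int n :: 'k::division_ring) \<noteq> 0"
    and q: "b \<noteq> 0" "q * of_int b = of_int a" "y * (of_int b :: 'k) = of_int a"
  shows "rat_embed q = y"
proof -
  have "(rat_embed q - y) * of_int b = 0"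
    using rat_embed_mult_denom[OF char0 q(1,2)] q(3) by (simp add: left_diff_distrib)
  then show ?thesis using char0[OF q(1)] by simp
qed

lemma rat_fraction:
  obtains a b where "b \<noteq> 0" "(q::rat) * of_int b = of_int a"
proof -
  have "q * of_int (snd (quotient_of q)) = of_int (fst (quotient_of q))"
    using quotient_of_div[of q] quotient_of_denom_pos'[of q]
    by (metis nonzero_divide_eq_eq of_int_eq_0_iff order_less_irrefl prod.collapse)
  with quotient_of_denom_pos'[of q] show thesis
    by (intro that[of "snd (quotient_of q)"]) auto
qed

lemma rat_embed_hom:
  assumes char0: "\<And>n::int. n \<noteq> 0 \<Longrightarrow> (of_int n :: 'k::division_ring) \<noteq> 0"
  shows "rat_embed (p + q) = rat_embed p + (rat_embed q :: 'k)"
    and "rat_embed (p * q) = rat_embed p * (rat_embed q :: 'k)"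
    and "rat_embed 1 = (1 :: 'k)"
    and "rat_embed q * y = y * (rat_embed q :: 'k)"
proof -
  obtain a b where p: "b \<noteq> 0" "p * of_int b = of_int a" by (rule rat_fraction)
  obtain c d where q: "d \<noteq> 0" "q * of_int d = of_int c" by (rule rat_fraction)
  note p' = rat_embed_mult_denom[OF char0 p] and q' = rat_embed_mult_denom[OF char0 q]
  have bd: "b * d \<noteq> 0" using p q by simp
  have comm: "of_int n * z = z * of_int n" for n and z :: 'k by (rule mult_of_int_commute)
  show "rat_embed (p + q) = rat_embed p + (rat_embed q :: 'k)"
  proof (rule rat_embed_eqI[OF char0 bd])
    have "(p + q) * of_int (b * d) = p * of_int b * of_int d + q * of_int d * of_int b"
      by (simp add: algebra_simps)
    then show "(p + q) * of_int (b * d) = of_int (a * d + c * b)"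
      by (simp add: p q)
    have "(rat_embed p + rat_embed q) * (of_int (b * d) :: 'k) =
        rat_embed p * of_int b * of_int d + rat_embed q * of_int d * of_int b"
      by (simp add: distrib_right mult.assoc comm[of b "of_int d"])
    then show "(rat_embed p + rat_embed q) * (of_int (b * d) :: 'k) = of_int (a * d + c * b)"
      by (simp add: p' q')
  qed
  show "rat_embed (p * q) = rat_embed p * (rat_embed q :: 'k)"
  proof (rule rat_embed_eqI[OF char0 bd])
    have "p * q * of_int (b * d) = (p * of_int b) * (q * of_int d)"
      by (simp add: algebra_simps)
    then show "p * q * of_int (b * d) = of_int (a * c)"
      by (simp add: p q)
    have "rat_embed p * rat_embed q * (of_int (b * d) :: 'k) =
        rat_embed p * of_int b * (rat_embed q * of_int d)"
      by (simp add: mult.assoc comm[of b])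
    then show "rat_embed p * rat_embed q * (of_int (b * d) :: 'k) = of_int (a * c)"
      by (simp add: p' q')
  qed
  show "rat_embed 1 = (1 :: 'k)"
    by (rule rat_embed_eqI[OF char0, of 1 _ 1]) simp_all
  \<comment> \<open>Integers are central, so after multiplication by the denominator both products
    become the same integer multiple of \<open>y\<close>.\<close>
  have "rat_embed q * y * of_int d = rat_embed q * of_int d * y"
    by (simp add: mult.assoc comm[of d y])
  moreover have "y * rat_embed q * of_int d = y * (rat_embed q * of_int d)"
    by (simp add: mult.assoc)
  ultimately have "(rat_embed q * y - y * rat_embed q) * of_int d = 0"
    by (simp add: left_diff_distrib q' comm[of c y])
  then show "rat_embed q * y = y * (rat_embed q :: 'k)"
    using char0[OF q(1)] by simp
qed

text \<open>The universal property of the algebra: words are evaluated in the skew field, and the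
  kernel of the linear extension is an ideal containing the relations.\<close>

lemma strip_alg_hom_exists:
  fixes W :: "mark \<Rightarrow> mark \<Rightarrow> 'k::division_ring"
  assumes char0: "\<And>n::int. n \<noteq> 0 \<Longrightarrow> (of_int n :: 'k) \<noteq> 0"
    and nz: "\<And>a b. a \<noteq> b \<Longrightarrow> W a b \<noteq> 0"
    and triangle: "\<And>a b c. distinct [a, b, c] \<Longrightarrow>
      W a b * inverse (W c b) * W c a = W a c * inverse (W b c) * W b a"
    and exchange: "\<And>a b c d. cyclic_seq [a, b, c, d] \<Longrightarrow>
      W b d = W b c * inverse (W a c) * W a d + W b a * inverse (W c a) * W c d"
  obtains \<phi> :: "strip_alg \<Rightarrow> 'k" where "\<And>x y. \<phi> (x + y) = \<phi> x + \<phi> y" "\<And>x y. \<phi> (x * y) = \<phi> x * \<phi> y"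
    "\<phi> 1 = 1" "\<And>a b. a \<noteq> b \<Longrightarrow> \<phi> (gen_x a b) = W a b"
proof -
  define lt where "lt = (\<lambda>(e, s). let (a, b) = Rep_arrow e in if s then W a b else inverse (W a b))"
  have lt_cancel: "lt (e, s) * lt (e, \<not> s) = 1" for e s
    using Rep_arrow[of e] nz by (auto simp: lt_def split: prod.splits)
  \<comment> \<open>The value is taken at a chosen word; \<open>m_abs\<close> shows that the choice
    is immaterial.\<close>
  define m where "m g = prod_list (map lt (rep_free_group g))" for g
  have m_abs: "m (abs_free_group w) = prod_list (map lt w)" for w
    unfolding m_def
  proof (rule prod_list_pres_eq[OF _ lt_cancel])
    show "pres_eq {} (rep_free_group (abs_free_group w)) w"
      by (simp flip: free_group.abs_eq_iff add: Quotient3_abs_rep[OF Quotient3_free_group])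
  qed simp
  interpret h: lin_ext_hom "rat_embed :: rat \<Rightarrow> 'k" m
  proof
    show "m 0 = 1"
      by (simp add: zero_free_group_def m_abs)
    show "m (g + g') = m g * m g'" for g g'
      by (induct g rule: free_group.abs_induct, induct g' rule: free_group.abs_induct)
        (simp add: plus_free_group.abs_eq m_abs)
  qed (rule rat_embed_hom, rule char0, assumption)+
  define ev where "ev = lin_ext (rat_embed :: rat \<Rightarrow> 'k) m"
  have ev_hom: "ev (p + q) = ev p + ev q" "ev (p - q) = ev p - ev q" "ev (p * q) = ev p * ev q"
    "ev (- p) = - ev p" "ev 0 = 0" "ev 1 = 1" for p q
    by (simp_all add: ev_def h.lin_ext_add h.lin_ext_minus h.lin_ext_mult
        h.lin_ext_uminus h.lin_ext_zero h.lin_ext_one)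
  have ev_fx: "ev (fx a b) = W a b" "ev (fx_inv a b) = inverse (W a b)" if "a \<noteq> b" for a b
    using that
    by (simp_all add: ev_def fx_def fx_inv_def h.lin_ext_single h.c_one free_gen.abs_eq
        uminus_free_group.abs_eq word_inv_def m_abs lt_def Abs_arrow_inverse)
  have "ideal {p. ev p = 0} (ring_of_type_algebra :: free_alg ring)"
  proof (rule idealI[OF ring_ring_of_type_algebra])
    interpret ring "ring_of_type_algebra :: free_alg ring"
      by (rule ring_ring_of_type_algebra)
    show "subgroup {p. ev p = 0} (add_monoid (ring_of_type_algebra :: free_alg ring))"
    proof (rule add.subgroupI)
      fix p assume "p \<in> {p. ev p = 0}"
      moreover have "\<ominus>\<^bsub>ring_of_type_algebra\<^esub> p = - p"
        by (rule minus_equality) (auto simp: ring_of_type_algebra_def)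
      ultimately show "\<ominus>\<^bsub>ring_of_type_algebra\<^esub> p \<in> {p. ev p = 0}"
        by (simp add: ev_hom)
    qed (auto simp: ring_of_type_algebra_def ev_hom intro: exI[of _ 0])
  qed (auto simp: ring_of_type_algebra_def ev_hom)
  moreover have "strip_rels \<subseteq> {p. ev p = 0}"
  proof -
    have "ev (fx b d) = ev (fx b c * fx_inv a c * fx a d + fx b a * fx_inv c a * fx c d)"
      if "cyclic_seq [a, b, c, d]" for a b c d
    proof -
      have "distinct [a, b, c, d]" using that by (simp add: cyclic_seq_def)
      then show ?thesis using exchange[OF that] by (auto simp: ev_hom ev_fx)
    qed
    moreover have "ev (fx a b * fx_inv c b * fx c a) = ev (fx a c * fx_inv b c * fx b a)"
      if "distinct [a, b, c]" for a b c
      using triangle[OF that] that by (auto simp: ev_hom ev_fx)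
    ultimately show ?thesis
      by (auto simp: strip_rels_def ev_hom(2))
  qed
  ultimately have ker: "strip_ideal \<subseteq> {p. ev p = 0}"
    unfolding strip_ideal_def by (rule ring.genideal_minimal[OF ring_ring_of_type_algebra])
  define \<phi> where "\<phi> y = ev (rep_strip_alg y)" for y
  have \<phi>_abs: "\<phi> (abs_strip_alg p) = ev p" for p
  proof -
    have "rep_strip_alg (abs_strip_alg p) - p \<in> strip_ideal"
      by (simp flip: strip_alg.abs_eq_iff add: Quotient3_abs_rep[OF Quotient3_strip_alg])
    with ker have "ev (rep_strip_alg (abs_strip_alg p) - p) = 0" by blast
    then show ?thesis by (simp add: \<phi>_def ev_hom)
  qed
  show thesis
  proof
    show "\<phi> (x + y) = \<phi> x + \<phi> y" for x y
      by (induct x rule: strip_alg.abs_induct, induct y rule: strip_alg.abs_induct)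
        (simp add: plus_strip_alg.abs_eq \<phi>_abs ev_hom)
    show "\<phi> (x * y) = \<phi> x * \<phi> y" for x y
      by (induct x rule: strip_alg.abs_induct, induct y rule: strip_alg.abs_induct)
        (simp add: times_strip_alg.abs_eq \<phi>_abs ev_hom)
    show "\<phi> 1 = 1"
      by (simp add: one_strip_alg_def \<phi>_abs ev_hom)
    show "\<phi> (gen_x a b) = W a b" if "a \<noteq> b" for a b
      using that by (simp add: gen_x.abs_eq \<phi>_abs ev_fx)
  qed
qed

section \<open>Factoring embeddings of the group ring through the algebra\<close>

lemma tri_group_induct [case_names zero gen gen_inv]:
  assumes "P 0"
    and "\<And>a b g. (a, b) \<in> triangulation \<Longrightarrow> P g \<Longrightarrow> P (tri_gen a b + g)"
    and "\<And>a b g. (a, b) \<in> triangulation \<Longrightarrow> P g \<Longrightarrow> P (- tri_gen a b + g)"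
  shows "P g"
proof (induct g rule: tri_group.abs_induct)
  fix w
  show "P (abs_tri_group w)"
  proof (induction w)
    case Nil
    then show ?case using assms(1) by (simp add: zero_tri_group_def)
  next
    case (Cons l w)
    obtain a b s where l: "l = (Abs_tri_arrow (a, b), s)" and ab: "(a, b) \<in> triangulation"
      by (metis Rep_tri_arrow Rep_tri_arrow_inverse surj_pair)
    have "abs_tri_group (l # w) = (if s then tri_gen a b else - tri_gen a b) + abs_tri_group w"
      by (simp add: l tri_gen.abs_eq uminus_tri_group.abs_eq plus_tri_group.abs_eq word_inv_def)
    with assms(2,3)[OF ab Cons] show ?case by simp
  qed
qed

lemma hom_of_int:
  fixes f :: "'a::ring_1 \<Rightarrow> 'b::ring_1"
  assumes add: "\<And>x y. f (x + y) = f x + f y" and one: "f 1 = 1"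
  shows "f (of_int n) = of_int n"
proof -
  have zero: "f 0 = 0" using add[of 0 0] by simp
  have uminus: "f (- x) = - f x" for x
    using add[of x "- x"] by (simp add: zero eq_neg_iff_add_eq_0 add.commute)
  have "f (of_nat m) = of_nat m" for m
    by (induction m) (simp_all add: zero add one)
  then show ?thesis
    by (cases n) (simp_all add: uminus del: of_nat_Suc)
qed

locale tri_embedding =
  fixes \<iota> :: "tri_ring \<Rightarrow> 'k::division_ring"
  assumes add: "\<iota> (p + q) = \<iota> p + \<iota> q"
    and mult: "\<iota> (p * q) = \<iota> p * \<iota> q"
    and one: "\<iota> 1 = 1"
    and inj: "inj \<iota>"
begin

lemma map_zero: "\<iota> 0 = 0"
  using add[of 0 0] by simp

lemma uminus: "\<iota> (- p) = - \<iota> p"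
  using add[of p "- p"] by (simp add: map_zero eq_neg_iff_add_eq_0 add.commute)

lemma nonzero: "p \<noteq> 0 \<Longrightarrow> \<iota> p \<noteq> 0"
  using inj map_zero by (metis injD)

lemma of_int: "\<iota> (of_int n) = of_int n"
  by (rule hom_of_int) (rule add one)+

lemma char0: "n \<noteq> 0 \<Longrightarrow> (of_int n :: 'k) \<noteq> 0"
proof -
  assume "n \<noteq> 0"
  then have "(of_int n :: tri_ring) \<noteq> 0"
    by (metis lookup_single_eq lookup_zero of_int_eq_id id_apply single_of_int)
  from nonzero[OF this] show ?thesis by (simp add: of_int)
qed

lemma mark_sgn: "\<iota> (mark_sgn a b) = mark_sgn a b"
  by (simp add: mark_sgn_def map_zero one uminus)

lemma inverse_tx: "\<iota> (ty a b) = inverse (\<iota> (tx a b))"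
  by (rule inverse_unique[symmetric]) (simp add: tx_ty one flip: mult)

lemma frieze_pluecker:
  assumes "a \<noteq> b"
  shows "\<iota> (frieze c d) = \<iota> (frieze c b) * inverse (\<iota> (frieze a b)) * \<iota> (frieze a d) +
    \<iota> (frieze c a) * inverse (\<iota> (frieze b a)) * \<iota> (frieze b d)"
proof (rule solves_pluecker[OF _ _ _ _ assms])
  show "solves (\<lambda>l. \<iota> (zig_C tx ty l)) (\<lambda>l. \<iota> (zig_D tx ty l)) (\<lambda>l. \<iota> (frieze k l))" for k
    by (simp add: solves_def frieze_rec add mult)
  have "zig_D tx ty l \<noteq> 0" for l
    using zig_D_E(1)[of tx ty l, OF tx_ty ty_tx] by force
  then show "\<iota> (zig_D tx ty l) \<noteq> 0" for l by (rule nonzero)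
qed (simp_all add: frieze_self map_zero nonzero frieze_nonzero)

text \<open>The signed frieze entries satisfy all relations of the algebra, and by
  \<open>frieze_zag\<close> they give back \<iota> on the generators of the group.\<close>

lemma extends_to_strip_alg:
  obtains \<phi> :: "strip_alg \<Rightarrow> 'k" where "\<And>x y. \<phi> (x + y) = \<phi> x + \<phi> y" "\<And>x y. \<phi> (x * y) = \<phi> x * \<phi> y"
    "\<phi> 1 = 1" "\<And>p. \<phi> (tri_incl p) = \<iota> p"
proof -
  define Z where "Z a b = \<iota> (frieze (zag a) (zag b))" for a b
  define W where "W a b = mark_sgn a b * Z a b" for a b
  have Z: "Z c d = Z c b * inverse (Z a b) * Z a d + Z c a * inverse (Z b a) * Z b d"
    if "a \<noteq> b" for a b c d
    unfolding Z_def using that by (intro frieze_pluecker) simp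
  have "Z a a = 0" for a
    by (simp add: Z_def frieze_self map_zero)
  note triangle = skew_pluecker_triangle[OF Z this W_def]
  note exchange = skew_pluecker_exchange[OF Z W_def]
  have "W a b \<noteq> 0" if "a \<noteq> b" for a b
    using that nonzero[OF frieze_nonzero[of "zag a" "zag b"]] by (auto simp: W_def Z_def mark_sgn_def)
  from strip_alg_hom_exists[of W, OF char0 this triangle exchange]
  obtain \<phi> :: "strip_alg \<Rightarrow> 'k" where \<phi>: "\<And>x y. \<phi> (x + y) = \<phi> x + \<phi> y"
    "\<And>x y. \<phi> (x * y) = \<phi> x * \<phi> y" "\<phi> 1 = 1" "\<And>a b. a \<noteq> b \<Longrightarrow> \<phi> (gen_x a b) = W a b"
    by blast
  \<comment> \<open>The sign occurs twice, in \<open>W\<close> and in \<open>frieze_zag\<close>, and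
    squares to one.\<close>
  have gen_tx: "\<phi> (tri_incl (tx a b)) = \<iota> (tx a b)" if "(a, b) \<in> triangulation" for a b
    using mark_sgn_square[OF triangulation_neq[OF that], where 'a = 'k]
    by (simp add: tri_incl_tx \<phi>(4) triangulation_neq that W_def Z_def frieze_zag mult mark_sgn
        flip: mult.assoc)
  have gen_ty: "\<phi> (tri_incl (ty a b)) = \<iota> (ty a b)" if "(a, b) \<in> triangulation" for a b
    unfolding inverse_tx
    by (rule inverse_unique[symmetric])
      (simp add: tx_ty tri_incl_hom \<phi>(3) flip: gen_tx[OF that] \<phi>(2) tri_incl_hom(2))
  have single: "\<phi> (tri_incl (Poly_Mapping.single g 1)) = \<iota> (Poly_Mapping.single g 1)" for g
  proof (induction g rule: tri_group_induct)
    case zero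
    then show ?case by (simp add: tri_incl_hom \<phi> one)
  next
    case (gen a b g)
    have "Poly_Mapping.single (tri_gen a b + g) 1 = tx a b * Poly_Mapping.single g 1"
      by (simp add: tx_def mult_single)
    with gen show ?case by (simp add: tri_incl_hom \<phi> mult gen_tx)
  next
    case (gen_inv a b g)
    have "Poly_Mapping.single (- tri_gen a b + g) 1 = ty a b * Poly_Mapping.single g 1"
      by (simp add: ty_def mult_single)
    with gen_inv show ?case by (simp add: tri_incl_hom \<phi> mult gen_ty)
  qed
  have \<phi>_zero: "\<phi> 0 = 0" using \<phi>(1)[of 0 0] by simp
  have \<phi>_of_int: "\<phi> (tri_incl (of_int n)) = of_int n" for n
    by (rule hom_of_int[of "\<lambda>p. \<phi> (tri_incl p)"]) (simp_all add: tri_incl_hom \<phi>)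
  have "\<phi> (tri_incl p) = \<iota> p" for p
  proof (induction p rule: poly_mapping_single_induct)
    case zero
    then show ?case by (simp add: tri_incl_def tri_incl.lin_ext_zero \<phi>_zero map_zero)
  next
    case (single_plus g n f)
    have "Poly_Mapping.single g n = of_int n * Poly_Mapping.single g 1"
      by (simp add: mult_single flip: single_of_int)
    with single_plus show ?case
      by (simp add: tri_incl_hom \<phi> single \<phi>_of_int add mult of_int)
  qed
  with \<phi>(1-3) show thesis by (rule that)
qed

text \<open>The injective map \<iota> factors through \<open>tri_incl\<close>. This makes
  \<open>the_inv tri_incl\<close> a genuine inverse on the range.\<close>

lemma inj_tri_incl: "inj tri_incl"
proof -
  obtain \<phi> where "\<And>p. \<phi> (tri_incl p) = \<iota> p" by (rule extends_to_strip_alg) blast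
  with inj show ?thesis by (metis injD injI)
qed

end

section \<open>Relations and angles\<close>

text \<open>The triangle relation turns the first summand into the angle at \<open>q\<close> between
  \<open>p\<close> and \<open>a\<close>; the second is built from \<open>a\<close> and
  \<open>r\<close>. The exchange relation for \<open>gen_x p r\<close> adds them to an angle free of
  \<open>a\<close>, whence the independence of \<open>j\<close>.\<close>

lemma gen_x_angle:
  assumes "cyclic_seq [q, p, a, r] \<or> cyclic_seq [a, p, q, r]"
  shows "gen_x_inv a q * (gen_x a p * gen_x_inv q p + gen_x a r * gen_x_inv q r) =
    gen_x_inv p q * gen_x p r * gen_x_inv q r"
proof -
  have "distinct [p, q, a]" using assms by (auto simp: cyclic_seq_def)
  from gen_x_triangle[OF this]
  have "gen_x_inv p q * (gen_x p q * gen_x_inv a q * gen_x a p) * gen_x_inv q p =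
      gen_x_inv p q * (gen_x p a * gen_x_inv q a * gen_x q p) * gen_x_inv q p"
    by simp
  then have "gen_x_inv a q * gen_x a p * gen_x_inv q p = gen_x_inv p q * gen_x p a * gen_x_inv q a"
    by (simp add: mult.assoc gen_x_right_inv)
  moreover have "gen_x p r = gen_x p q * gen_x_inv a q * gen_x a r + gen_x p a * gen_x_inv q a * gen_x q r"
    using assms gen_x_exchange[of q p a r] gen_x_exchange[of a p q r] by (auto simp: add.commute)
  ultimately show ?thesis
    by (simp add: distrib_left distrib_right mult.assoc gen_x_right_inv)
qed

lemma unit_inv_gen_x_inv: "unit_inv (gen_x_inv a b) = gen_x a b"
  by (rule unit_inv_eqI) (rule gen_x_right_inv gen_x_left_inv)+

lemma gen_x_in_range: "a \<noteq> b \<Longrightarrow> gen_x a b \<in> range tri_incl"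
  by (simp add: gen_x_eq_tri_incl)

lemma gen_x_inv_in_range: "(a, b) \<in> triangulation \<Longrightarrow> gen_x_inv a b \<in> range tri_incl"
  by (metis tri_incl_ty rangeI)

lemma mult_in_range: "x \<in> range tri_incl \<Longrightarrow> y \<in> range tri_incl \<Longrightarrow> x * y \<in> range tri_incl"
  by (metis (no_types, lifting) imageE rangeI tri_incl_hom(2))

lemma in_triangulation:
  "(Plus i, Plus (i + 1)) \<in> triangulation" "(Plus (i + 1), Plus i) \<in> triangulation"
  "(Minus i, Minus (i + 1)) \<in> triangulation" "(Minus (i + 1), Minus i) \<in> triangulation"
  by (auto simp: triangulation_def)

lemma U_V_relations:
  "U_el (i + 1) j * A_el j * V_el (j + 1) i = unit_inv (B_el i) + U_el (i + 1) (j + 1) * A_bar j * V_el j i"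
  "V_el (i + 1) j * B_el j * U_el (j + 1) i = unit_inv (A_el i) + V_el (i + 1) (j + 1) * B_bar j * U_el j i"
  "U_el i j * A_el j * V_el (j + 1) i = U_el i (j + 1) * A_bar j * V_el j i"
  "V_el i j * B_el j * U_el (j + 1) i = V_el i (j + 1) * B_bar j * U_el j i"
proof -
  note defs = U_el_def V_el_def A_el_def B_el_def A_bar_def B_bar_def unit_inv_gen_x unit_inv_gen_x_inv
  show "U_el (i + 1) j * A_el j * V_el (j + 1) i = unit_inv (B_el i) + U_el (i + 1) (j + 1) * A_bar j * V_el j i"
    \<comment> \<open>Two neighbours on each line: the left side of the Pluecker relation is the
      inverse of \<open>B_el i\<close> up to sign.\<close>
    using sx_pluecker[of "Plus j" "Plus (j + 1)" "Minus (i + 1)" "Minus i"]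
    by (simp add: defs sx_def sy_def mark_sgn_def algebra_simps)
  show "V_el (i + 1) j * B_el j * U_el (j + 1) i = unit_inv (A_el i) + V_el (i + 1) (j + 1) * B_bar j * U_el j i"
    using sx_pluecker[of "Minus j" "Minus (j + 1)" "Plus (i + 1)" "Plus i"]
    by (simp add: defs sx_def sy_def mark_sgn_def algebra_simps)
  show "U_el i j * A_el j * V_el (j + 1) i = U_el i (j + 1) * A_bar j * V_el j i"
    unfolding defs by (rule gen_x_triangle) simp
  show "V_el i j * B_el j * U_el (j + 1) i = V_el i (j + 1) * B_bar j * U_el j i"
    unfolding defs by (rule gen_x_triangle) simp
qed

section \<open>The angles in the skew field\<close>

context tri_embedding
begin

lemma inverse_in_frac_sum:
  assumes pqr: "(p, q) \<in> triangulation" "(q, p) \<in> triangulation" "(q, r) \<in> triangulation" "p \<noteq> r"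
  obtains h where "h \<in> range \<iota>" "\<And>a. cyclic_seq [q, p, a, r] \<or> cyclic_seq [a, p, q, r] \<Longrightarrow>
    inverse (in_frac \<iota> (gen_x a q)) * (in_frac \<iota> (gen_x a p) * in_frac \<iota> (gen_x_inv q p) +
      in_frac \<iota> (gen_x a r) * in_frac \<iota> (gen_x_inv q r)) = h"
proof -
  obtain \<phi> :: "strip_alg \<Rightarrow> 'k" where \<phi>: "\<And>x y. \<phi> (x + y) = \<phi> x + \<phi> y"
    "\<And>x y. \<phi> (x * y) = \<phi> x * \<phi> y" "\<phi> 1 = 1" "\<And>p. \<phi> (tri_incl p) = \<iota> p"
    by (rule extends_to_strip_alg) blast
  have in_frac: "in_frac \<iota> y = \<phi> y" if "y \<in> range tri_incl" for y
    using that by (auto simp: in_frac_def the_inv_f_f[OF inj_tri_incl] \<phi>(4))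
  have inverse: "inverse (\<phi> (gen_x a b)) = \<phi> (gen_x_inv a b)" for a b
    by (rule inverse_unique) (simp add: gen_x_right_inv \<phi>(3) flip: \<phi>(2))
  \<comment> \<open>The outer factors belong to triangulation arrows, whose inverses lie in the
    group ring; the middle factor lies there because every generator does.\<close>
  define h where "h = gen_x_inv p q * gen_x p r * gen_x_inv q r"
  have "h \<in> range tri_incl"
    unfolding h_def by (intro mult_in_range gen_x_in_range gen_x_inv_in_range pqr)
  then have "\<phi> h \<in> range \<iota>" using \<phi>(4) by auto
  moreover have "inverse (in_frac \<iota> (gen_x a q)) * (in_frac \<iota> (gen_x a p) * in_frac \<iota> (gen_x_inv q p) +
      in_frac \<iota> (gen_x a r) * in_frac \<iota> (gen_x_inv q r)) = \<phi> h"
    if "cyclic_seq [q, p, a, r] \<or> cyclic_seq [a, p, q, r]" for a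
  proof -
    have "a \<noteq> q" "a \<noteq> p" "a \<noteq> r" using that by (auto simp: cyclic_seq_def)
    then show ?thesis
      by (simp add: in_frac gen_x_in_range gen_x_inv_in_range pqr inverse h_def
          flip: gen_x_angle[OF that] \<phi>(1,2))
  qed
  ultimately show thesis by (rule that)
qed

text \<open>This ensures that the inverses in \<open>H_plus\<close> and \<open>H_minus\<close> are
  true ones and not the default \<open>inverse 0 = 0\<close>.\<close>

lemma in_frac_gen_x_nonzero:
  assumes "a \<noteq> b"
  shows "in_frac \<iota> (gen_x a b) \<noteq> 0"
proof
  obtain p where p: "gen_x a b = tri_incl p" using gen_x_in_range[OF assms] by blast
  assume "in_frac \<iota> (gen_x a b) = 0"
  then have "\<iota> p = 0" by (simp add: in_frac_def p the_inv_f_f[OF inj_tri_incl])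
  then have "p = 0" using nonzero by blast
  then show False using p gen_x_nonzero[of a b] by (simp add: tri_incl_def tri_incl.lin_ext_zero)
qed

lemma H_plus_constant: "\<exists>h\<in>range \<iota>. \<forall>j. H_plus \<iota> i j = h"
proof -
  obtain h where h: "h \<in> range \<iota>" "\<And>a. cyclic_seq [Plus i, Plus (i - 1), a, Plus (i + 1)] \<or>
      cyclic_seq [a, Plus (i - 1), Plus i, Plus (i + 1)] \<Longrightarrow>
    inverse (in_frac \<iota> (gen_x a (Plus i))) *
    (in_frac \<iota> (gen_x a (Plus (i - 1))) * in_frac \<iota> (gen_x_inv (Plus i) (Plus (i - 1))) +
      in_frac \<iota> (gen_x a (Plus (i + 1))) * in_frac \<iota> (gen_x_inv (Plus i) (Plus (i + 1)))) = h"
    by (rule inverse_in_frac_sum[of "Plus (i - 1)" "Plus i" "Plus (i + 1)"])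
      (use in_triangulation[of i] in_triangulation[of "i - 1"] in auto)
  \<comment> \<open>The plus line is ordered backwards, so the first cyclic order applies.\<close>
  have "H_plus \<iota> i j = h" for j
    using h(2)[of "Minus j"] by (simp add: H_plus_def U_el_def A_el_def A_bar_def unit_inv_gen_x cyclic_seq4I)
  with h(1) show ?thesis by blast
qed

lemma H_minus_constant: "\<exists>h\<in>range \<iota>. \<forall>j. H_minus \<iota> i j = h"
proof -
  obtain h where h: "h \<in> range \<iota>" "\<And>a. cyclic_seq [Minus i, Minus (i - 1), a, Minus (i + 1)] \<or>
      cyclic_seq [a, Minus (i - 1), Minus i, Minus (i + 1)] \<Longrightarrow>
    inverse (in_frac \<iota> (gen_x a (Minus i))) *
    (in_frac \<iota> (gen_x a (Minus (i - 1))) * in_frac \<iota> (gen_x_inv (Minus i) (Minus (i - 1))) +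
      in_frac \<iota> (gen_x a (Minus (i + 1))) * in_frac \<iota> (gen_x_inv (Minus i) (Minus (i + 1)))) = h"
    by (rule inverse_in_frac_sum[of "Minus (i - 1)" "Minus i" "Minus (i + 1)"])
      (use in_triangulation[of i] in_triangulation[of "i - 1"] in auto)
  \<comment> \<open>Here the three points increase and lie below \<open>Plus j\<close>, so the
    second cyclic order applies.\<close>
  have "H_minus \<iota> i j = h" for j
    using h(2)[of "Plus j"] by (simp add: H_minus_def V_el_def B_el_def B_bar_def unit_inv_gen_x cyclic_seq4I)
  with h(1) show ?thesis by blast
qed

end

section \<open>Passage to the universal field of fractions\<close>

lemma universal_field_of_fractions_tri_embedding:
  assumes "universal_field_of_fractions ring_of_type_algebra ring_of_type_algebra \<iota>"
  shows "tri_embedding (\<iota> :: tri_ring \<Rightarrow> 'k::division_ring)"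
proof -
  have "\<iota> \<in> ring_hom ring_of_type_algebra ring_of_type_algebra" "inj_on \<iota> (carrier ring_of_type_algebra)"
    using assms by (auto simp: universal_field_of_fractions_def epic_field_def)
  then show ?thesis
    by unfold_locales (auto simp: ring_hom_def ring_of_type_algebra_def)
qed

theorem theorem4p11:
  shows "(\<forall>i j. U_el i j \<in> range tri_incl \<and> V_el i j \<in> range tri_incl) \<and>
    (\<forall>i j.
      U_el (i + 1) j * A_el j * V_el (j + 1) i = unit_inv (B_el i) + U_el (i + 1) (j + 1) * A_bar j * V_el j i \<and>
      V_el (i + 1) j * B_el j * U_el (j + 1) i = unit_inv (A_el i) + V_el (i + 1) (j + 1) * B_bar j * U_el j i \<and>
      U_el i j * A_el j * V_el (j + 1) i = U_el i (j + 1) * A_bar j * V_el j i \<and>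
      V_el i j * B_el j * U_el (j + 1) i = V_el i (j + 1) * B_bar j * U_el j i) \<and>
    (\<forall>\<iota> :: tri_ring \<Rightarrow> 'k::division_ring.
      universal_field_of_fractions ring_of_type_algebra ring_of_type_algebra \<iota> \<longrightarrow>
      (\<forall>i j. in_frac \<iota> (U_el i j) \<noteq> 0 \<and> in_frac \<iota> (V_el i j) \<noteq> 0) \<and>
      (\<forall>i j j'. H_plus \<iota> i j = H_plus \<iota> i j' \<and> H_minus \<iota> i j = H_minus \<iota> i j') \<and>
      (\<forall>i j. H_plus \<iota> i j \<in> range \<iota> \<and> H_minus \<iota> i j \<in> range \<iota>))"
proof (intro conjI[of "\<forall>i j. _ i j"] conjI[of "\<forall>\<iota>. _ \<iota>"] allI impI)
  show "U_el i j \<in> range tri_incl \<and> V_el i j \<in> range tri_incl" for i j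
    by (simp add: U_el_def V_el_def gen_x_in_range)
next
  fix \<iota> :: "tri_ring \<Rightarrow> 'k"
  assume "universal_field_of_fractions ring_of_type_algebra ring_of_type_algebra \<iota>"
  then interpret tri_embedding \<iota>
    by (rule universal_field_of_fractions_tri_embedding)
  show "in_frac \<iota> (U_el i j) \<noteq> 0 \<and> in_frac \<iota> (V_el i j) \<noteq> 0" for i j
    by (simp add: U_el_def V_el_def in_frac_gen_x_nonzero)
  show "H_plus \<iota> i j = H_plus \<iota> i j' \<and> H_minus \<iota> i j = H_minus \<iota> i j'" for i j j'
    by (metis H_plus_constant H_minus_constant)
  show "H_plus \<iota> i j \<in> range \<iota> \<and> H_minus \<iota> i j \<in> range \<iota>" for i j
    by (metis H_plus_constant H_minus_constant)
qed (rule U_V_relations | intro conjI)+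

end
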